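(* Let $G$ be a totally disconnected locally compact group, $\alpha\in\mathrm{End}(G)$ and $U\le G$ a compact open subgroup. Then $U$ is tidy for $\alpha$ if and only if $U$ is minimizing for $\alpha$. In this case, $s(\alpha)=|\mathrm{out}_{\Gamma_+}(v_0)|$.
   Context: $\mathrm{End}(G)$ is the semigroup of continuous homomorphisms $G\to G$; $\alpha^{-i}$ denotes preimage under $\alpha^i$. Set $U_0:=U$, $U_{n+1}:=U\cap\alpha(U_n)$ and $U_{-n}:=\bigcap_{k=0}^n\alpha^{-k}(U)$ for $n\in\mathbb{N}_0$; $U_+:=\bigcap_{n\in\mathbb{N}_0}U_n$, $U_-:=\bigcap_{n\in\mathbb{N}_0}U_{-n}$, $U_{--}:=\bigcup_{n\in\mathbb{N}_0}\alpha^{-n}(U_-)$. $U$ is tidy above for $\alpha$ if $U=U_+U_-$, tidy below for $\alpha$ if $U_{--}$ is closed in $G$, and tidy for $\alpha$ if it is both. The scale is $s(\alpha)=\min\{[\alpha(W):W\cap\alpha(W)]\mid W\le G\text{ compact open}\}$; $U$ is minimizing for $\alpha$ if $[\alpha(U):\alpha(U)\cap U]=s(\alpha)$. For $i\in\mathbb{N}_0$ let $v_{-i}:=\alpha^{-i}(U)$, considered as an element of the power set of $G$. $\Gamma_+$ has vertex set $\{uv_{-i}\mid u\in U,\ i\in\mathbb{N}_0\}$ (left cosets $u\alpha^{-i}(U)$, equal iff equal as subsets of $G$) and edge set $\{(uv_{-i},uv_{-i-1})\mid u\in U,\ i\in\mathbb{N}_0\}$, taken literally as a set of pairs (so $(v_0,v_0)$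 is included if $\alpha^{-1}(U)=U$). $\mathrm{out}_{\Gamma_+}(v_0)$ is the set of vertices $w$ such that $(v_0,w)$ is an edge. *)

theory Defs
  imports
    "HOL-Analysis.Abstract_Topological_Spaces"
    "HOL-Algebra.Left_Coset"
    "Graph_Theory.Pair_Digraph"
begin

locale topological_group = group G for G :: "('a, 'b) monoid_scheme" (structure) +
  fixes T :: "'a topology"
  assumes topspace_eq: "topspace T = carrier G"
    and continuous_mult: "continuous_map (prod_topology T T) T (\<lambda>(x, y). x \<otimes> y)"
    and continuous_inv: "continuous_map T T (\<lambda>x. inv x)"

definition totally_disconnected_space :: "'a topology \<Rightarrow> bool" where
  "totally_disconnected_space T \<longleftrightarrow> (\<forall>S. connectedin T S \<longrightarrow> (\<exists>a. S \<subseteq> {a}))"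

text \<open>No separation axiom is listed: totally disconnected spaces are T1, and T1 topological
  groups are Hausdorff.\<close>

locale tdlc_group = topological_group +
  assumes locally_compact: "locally_compact_space T"
    and totally_disconnected: "totally_disconnected_space T"

definition continuous_End :: "('a, 'b) monoid_scheme \<Rightarrow> 'a topology \<Rightarrow> ('a \<Rightarrow> 'a) set" where
  "continuous_End G T = {\<alpha> \<in> hom G G. continuous_map T T \<alpha>}"

definition compact_open_subgroup ::
    "('a, 'b) monoid_scheme \<Rightarrow> 'a topology \<Rightarrow> 'a set \<Rightarrow> bool" where
  "compact_open_subgroup G T U \<longleftrightarrow> subgroup U G \<and> compactin T U \<and> openin T U"

definition preimage_pow ::
    "('a, 'b) monoid_scheme \<Rightarrow> ('a \<Rightarrow> 'a) \<Rightarrow> nat \<Rightarrow> 'a set \<Rightarrow> 'a set" where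
  "preimage_pow G \<alpha> i S = {x \<in> carrier G. (\<alpha> ^^ i) x \<in> S}"

primrec U_pos :: "('a \<Rightarrow> 'a) \<Rightarrow> 'a set \<Rightarrow> nat \<Rightarrow> 'a set" where
  "U_pos \<alpha> U 0 = U"
| "U_pos \<alpha> U (Suc n) = U \<inter> \<alpha> ` U_pos \<alpha> U n"

definition U_neg ::
    "('a, 'b) monoid_scheme \<Rightarrow> ('a \<Rightarrow> 'a) \<Rightarrow> 'a set \<Rightarrow> nat \<Rightarrow> 'a set" where
  "U_neg G \<alpha> U n = (\<Inter>k\<in>{0..n}. preimage_pow G \<alpha> k U)"

definition U_plus :: "('a \<Rightarrow> 'a) \<Rightarrow> 'a set \<Rightarrow> 'a set" where
  "U_plus \<alpha> U = (\<Inter>n. U_pos \<alpha> U n)"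

definition U_minus :: "('a, 'b) monoid_scheme \<Rightarrow> ('a \<Rightarrow> 'a) \<Rightarrow> 'a set \<Rightarrow> 'a set" where
  "U_minus G \<alpha> U = (\<Inter>n. U_neg G \<alpha> U n)"

definition U_minus_minus :: "('a, 'b) monoid_scheme \<Rightarrow> ('a \<Rightarrow> 'a) \<Rightarrow> 'a set \<Rightarrow> 'a set" where
  "U_minus_minus G \<alpha> U = (\<Union>n. preimage_pow G \<alpha> n (U_minus G \<alpha> U))"

definition tidy_above :: "('a, 'b) monoid_scheme \<Rightarrow> ('a \<Rightarrow> 'a) \<Rightarrow> 'a set \<Rightarrow> bool" where
  "tidy_above G \<alpha> U \<longleftrightarrow> U = U_plus \<alpha> U <#>\<^bsub>G\<^esub> U_minus G \<alpha> U"

definition tidy_below ::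
    "('a, 'b) monoid_scheme \<Rightarrow> 'a topology \<Rightarrow> ('a \<Rightarrow> 'a) \<Rightarrow> 'a set \<Rightarrow> bool" where
  "tidy_below G T \<alpha> U \<longleftrightarrow> closedin T (U_minus_minus G \<alpha> U)"

definition tidy ::
    "('a, 'b) monoid_scheme \<Rightarrow> 'a topology \<Rightarrow> ('a \<Rightarrow> 'a) \<Rightarrow> 'a set \<Rightarrow> bool" where
  "tidy G T \<alpha> U \<longleftrightarrow> tidy_above G \<alpha> U \<and> tidy_below G T \<alpha> U"

text \<open>The index \<open>[K : H]\<close> of subgroups \<open>H \<subseteq> K\<close> of \<open>G\<close>, with value \<open>0\<close> if it is infinite. It is
  only applied to \<open>K = \<alpha>(W)\<close> and \<open>H = \<alpha>(W) \<inter> W\<close> with \<open>W\<close> compact open and \<open>\<alpha>\<close> continuous, where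
  \<open>H\<close> is open in the compact group \<open>K\<close>, so that the index is finite.\<close>

definition subgroup_index ::
    "('a, 'b) monoid_scheme \<Rightarrow> 'a set \<Rightarrow> 'a set \<Rightarrow> nat" where
  "subgroup_index G K H = card (lcosets\<^bsub>G\<lparr>carrier := K\<rparr>\<^esub> H)"

definition displacement_index ::
    "('a, 'b) monoid_scheme \<Rightarrow> ('a \<Rightarrow> 'a) \<Rightarrow> 'a set \<Rightarrow> nat" where
  "displacement_index G \<alpha> W = subgroup_index G (\<alpha> ` W) (\<alpha> ` W \<inter> W)"

text \<open>The minimum ranges over a nonempty set, by van Dantzig's theorem.\<close>

definition endo_scale :: "('a, 'b) monoid_scheme \<Rightarrow> 'a topology \<Rightarrow> ('a \<Rightarrow> 'a) \<Rightarrow> nat" where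
  "endo_scale G T \<alpha> = (LEAST n. \<exists>W. compact_open_subgroup G T W \<and> n = displacement_index G \<alpha> W)"

definition minimizing ::
    "('a, 'b) monoid_scheme \<Rightarrow> 'a topology \<Rightarrow> ('a \<Rightarrow> 'a) \<Rightarrow> 'a set \<Rightarrow> bool" where
  "minimizing G T \<alpha> U \<longleftrightarrow> displacement_index G \<alpha> U = endo_scale G T \<alpha>"

text \<open>\<open>base_vertex G \<alpha> U i\<close> is the vertex \<open>v\<^sub>-\<^sub>i\<close>.\<close>

definition base_vertex ::
    "('a, 'b) monoid_scheme \<Rightarrow> ('a \<Rightarrow> 'a) \<Rightarrow> 'a set \<Rightarrow> nat \<Rightarrow> 'a set" where
  "base_vertex G \<alpha> U i = preimage_pow G \<alpha> i U"

definition Gamma_plus ::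
    "('a, 'b) monoid_scheme \<Rightarrow> ('a \<Rightarrow> 'a) \<Rightarrow> 'a set \<Rightarrow> 'a set pair_pre_digraph" where
  "Gamma_plus G \<alpha> U =
    \<lparr> pverts = {u <#\<^bsub>G\<^esub> base_vertex G \<alpha> U i | u i. u \<in> U},
      parcs = {(u <#\<^bsub>G\<^esub> base_vertex G \<alpha> U i, u <#\<^bsub>G\<^esub> base_vertex G \<alpha> U (i + 1)) | u i. u \<in> U} \<rparr>"

definition out_neighbours :: "'v pair_pre_digraph \<Rightarrow> 'v \<Rightarrow> 'v set" where
  "out_neighbours \<Gamma> v = {w \<in> pverts \<Gamma>. (v, w) \<in> parcs \<Gamma>}"

end

theory Submission
  imports Defs "HOL-Analysis.Urysohn"
begin

text \<open>For a compact open subgroup \<open>W\<close> let \<open>d\<^sub>n(W) = [\<alpha>\<^sup>n(W) : \<alpha>\<^sup>n(W) \<inter> W]\<close>, so that the scale is the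
  minimum of \<open>d\<^sub>1\<close>. Everything is deduced from the growth of the sequence \<open>d\<^sub>n(W)\<close>.

  Counting cosets shows \<open>d\<^sub>m\<^sub>+\<^sub>n(W) \<le> d\<^sub>m(W) d\<^sub>n(W)\<close> and, for any two compact open subgroups,
  \<open>d\<^sub>n(W) \<le> C d\<^sub>n(V)\<close> with \<open>C\<close> independent of \<open>n\<close>. Hence if \<open>W\<close> is \<^emph>\<open>multiplicative\<close>, that is
  \<open>d\<^sub>n(W) = d\<^sub>1(W)\<^sup>n\<close> for all \<open>n\<close>, then \<open>d\<^sub>1(W)\<^sup>n = d\<^sub>n(W) \<le> C d\<^sub>n(V) \<le> C d\<^sub>1(V)\<^sup>n\<close> for all \<open>n\<close> and
  therefore \<open>d\<^sub>1(W) \<le> d\<^sub>1(V)\<close>: multiplicative subgroups are minimizing (\<open>multiplicative_minimal\<close>). As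
  soon as one multiplicative subgroup exists, a similar comparison shows that, conversely, every
  minimizing subgroup is multiplicative (\<open>multiplicative_if_minimal\<close>). It remains to prove that
  multiplicative subgroups exist and are the same as tidy subgroups.

  \<^item> Multiplicative implies tidy (\<open>multiplicative_imp_tidy\<close>). The estimates
    \<open>d\<^sub>n(U) \<le> [U : U\<^sub>-\<^sub>n] \<le> d\<^sub>1(U)\<^sup>n\<close> become equalities. The first one gives
    \<open>U \<inter> \<alpha>\<^sup>-\<^sup>n(U) = U\<^sub>-\<^sub>n\<close>, so an orbit that leaves \<open>U\<close> never returns, \<open>U \<inter> U\<^sub>-\<^sub>- = U\<^sub>-\<close>, and
    \<open>U\<^sub>-\<^sub>-\<close> is closed. The second one gives \<open>U\<^sub>-\<^sub>k = \<alpha>(U\<^sub>-\<^sub>k\<^sub>-\<^sub>1) U\<^sub>-\<^sub>k\<^sub>-\<^sub>1\<close> for all \<open>k\<close>, whence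
    \<open>U = U\<^sub>n U\<^sub>-\<^sub>n\<close> for all \<open>n\<close> and \<open>U = U\<^sub>+ U\<^sub>-\<close> by compactness.

  \<^item> A criterion (\<open>multiplicative_if_factorization\<close>): \<open>W = M B\<close> is multiplicative if \<open>M\<close> is a subgroup
    with \<open>M \<subseteq> \<alpha>(M)\<close>, if \<open>\<alpha>(B) \<subseteq> B\<close>, and if an element of \<open>M\<close> some iterate of which is in \<open>B\<close>
    lies in \<open>B\<close> itself.

  \<^item> Tidy implies multiplicative (\<open>tidy_imp_multiplicative\<close>): take \<open>M = U\<^sub>+\<close> and \<open>B = U\<^sub>-\<close>. By Baire's
    theorem, closedness of \<open>U\<^sub>-\<^sub>-\<close> bounds the time that elements of \<open>U \<inter> U\<^sub>-\<^sub>-\<close> need to enter \<open>U\<^sub>-\<close>.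
    An element of \<open>U\<^sub>+\<close> has a past in \<open>U\<^sub>+\<close> that is longer than this bound, so it has already
    entered.

  \<^item> Existence (\<open>exists_multiplicative\<close>). Start from any \<open>U\<close> and let \<open>L\<close> be the group of all points
    that have a backward orbit eventually in \<open>U\<^sub>+\<close> and a forward orbit eventually in \<open>U\<^sub>-\<close>. If
    \<open>U\<close> is tidy above, it fails to be tidy below exactly when \<open>L \<inter> U\<^sub>+\<close> has points outside \<open>U\<^sub>-\<close>, so
    the idea is to make \<open>L\<close> a part of the subgroup. One has \<open>\<alpha>(L) = L\<close>, and \<open>L\<close> meets only finitely
    many cosets of \<open>U\<close>. Hence \<open>\<Inter> {l U l\<^sup>-\<^sup>1 | l \<in> L}\<close> is still open; it has a compact open subgroup \<open>V\<close>
    normalized by \<open>L\<close> with \<open>V = V\<^sub>+ V\<^sub>-\<close>, and the criterion applies to \<open>W = V L\<close> with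
    \<open>M = V\<^sub>+ L\<close> and \<open>B = V\<^sub>- L\<close>.

  Finally, the out-neighbours of \<open>v\<^sub>0\<close> are the cosets \<open>u \<alpha>\<^sup>-\<^sup>1(U)\<close> with \<open>u \<in> U\<close>, and there are
  \<open>[U : U \<inter> \<alpha>\<^sup>-\<^sup>1(U)] = d\<^sub>1(U)\<close> of them.\<close>

(* The ASCII notation for multiset inclusion would make left cosets ambiguous. *)
no_notation (ASCII) subset_mset (infix \<open><#\<close> 50)

section \<open>Counting left translates\<close>

text \<open>The index \<open>[A : A \<inter> B]\<close> is encoded as the number of left translates \<open>aB\<close> with \<open>a \<in> A\<close>. In this
  form it obeys a triangle inequality for subgroups that are not nested.\<close>
definition (in group) translates :: "'a set \<Rightarrow> 'a set \<Rightarrow> 'a set set" where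
  "translates A B = (\<lambda>a. a <# B) ` A"

abbreviation (in group) index :: "'a set \<Rightarrow> 'a set \<Rightarrow> nat" where
  "index A B \<equiv> card (translates A B)"

lemma card_images_same_kernel:
  assumes "\<And>x y. x \<in> A \<Longrightarrow> y \<in> A \<Longrightarrow> f x = f y \<longleftrightarrow> g x = g y"
  shows "card (f ` A) = card (g ` A)"
proof -
  define h where "h = g \<circ> inv_into A f"
  have h: "h (f x) = g x" if "x \<in> A" for x
  proof -
    have "inv_into A f (f x) \<in> A" "f (inv_into A f (f x)) = f x"
      using that by (auto intro: inv_into_into f_inv_into_f)
    then show ?thesis
      using assms[OF _ that] by (auto simp: h_def)
  qed
  have "h ` f ` A = g ` A"
    using h by (auto simp: image_iff)
  moreover have "inj_on h (f ` A)"
    using h assms by (auto simp: inj_on_def)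
  ultimately show ?thesis
    by (metis card_image)
qed

text \<open>A constant factor does not affect exponential growth rates; this is how inequalities between
  displacement indices are obtained from estimates up to a constant.\<close>
lemma pow_le_const_mult_pow_imp_le:
  fixes a b C :: nat
  assumes "\<And>n. b ^ n \<le> C * a ^ n"
  shows "b \<le> a"
proof (rule ccontr)
  assume "\<not> b \<le> a"
  show False
  proof (cases "a = 0")
    case True
    with assms[of 1] \<open>\<not> b \<le> a\<close> show False by simp
  next
    case False
    then have q: "real b / real a > 1"
      using \<open>\<not> b \<le> a\<close> by (simp add: field_simps)
    then obtain n where "real C < (real b / real a) ^ n"
      using real_arch_pow by blast
    then have "real C * real a ^ n < real b ^ n"
      using False by (simp add: power_divide field_simps)
    then have "real (C * a ^ n) < real (b ^ n)"
      by simp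
    with assms[of n] show False
      by (simp only: of_nat_less_iff)
  qed
qed

context group
begin

lemma mult_inv_cancel_left:
  assumes "x \<in> carrier G" "y \<in> carrier G"
  shows "inv x \<otimes> (x \<otimes> y) = y" "x \<otimes> (inv x \<otimes> y) = y"
  using assms by (simp_all add: m_assoc[symmetric])

lemma lcoset_eq_iff:
  assumes "subgroup B G" "a \<in> carrier G" "b \<in> carrier G"
  shows "a <# B = b <# B \<longleftrightarrow> inv a \<otimes> b \<in> B"
proof
  assume "a <# B = b <# B"
  with lcos_self[OF assms(3,1)] have "b \<in> a <# B" by simp
  then show "inv a \<otimes> b \<in> B"
    using subgroup.lcos_module_imp[OF assms(1) is_group assms(2)] by blast
next
  assume "inv a \<otimes> b \<in> B"
  then have "b \<in> a <# B"
    using subgroup.lcos_module_rev[OF assms(1) is_group assms(2,3)] by blast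
  then show "a <# B = b <# B"
    using l_repr_independence assms by blast
qed

lemma translates_transversal:
  assumes "finite (translates A B)"
  obtains F where "F \<subseteq> A" "finite F" "inj_on (\<lambda>a. a <# B) F" "card F = index A B"
    "translates A B = (\<lambda>a. a <# B) ` F"
proof -
  obtain F where F: "F \<subseteq> A" "inj_on (\<lambda>a. a <# B) F" "translates A B = (\<lambda>a. a <# B) ` F"
    using subset_image_inj[of "translates A B" "\<lambda>a. a <# B" A] unfolding translates_def by auto
  moreover have "finite F"
    using F assms finite_image_iff by metis
  moreover have "card F = index A B"
    using F card_image by metis
  ultimately show thesis
    using that by blast
qed

text \<open>If \<open>F\<close> represents the translates of \<open>B\<close> by \<open>A\<close>, and \<open>H\<close> those of \<open>C\<close> by \<open>B\<close>, then the products \<open>f h\<close>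
  represent all translates of \<open>C\<close> by \<open>A\<close>. This underlies both the triangle inequality and, for
  nested subgroups, the tower law.\<close>
lemma translates_subset_mult:
  assumes "A \<subseteq> carrier G" "subgroup B G" "subgroup C G"
    and F: "F \<subseteq> A" "translates A B = (\<lambda>a. a <# B) ` F"
    and H: "H \<subseteq> B" "translates B C = (\<lambda>a. a <# C) ` H"
  shows "translates A C \<subseteq> (\<lambda>(f, h). (f \<otimes> h) <# C) ` (F \<times> H)"
proof
  fix X assume "X \<in> translates A C"
  then obtain a where a: "a \<in> A" "X = a <# C"
    by (auto simp: translates_def)
  then have "a <# B \<in> (\<lambda>a. a <# B) ` F"
    using F(2) by (auto simp: translates_def)
  then obtain f where f: "f \<in> F" "a <# B = f <# B" by auto
  note c [simp] = subsetD[OF assms(1)] subgroup.mem_carrier[OF assms(2)]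
  have car: "a \<in> carrier G" "f \<in> carrier G"
    using a f F(1) by auto
  have "inv f \<otimes> a \<in> B"
    using f lcoset_eq_iff[OF assms(2)] car by metis
  moreover from this have "(inv f \<otimes> a) <# C \<in> (\<lambda>a. a <# C) ` H"
    using H(2) by (auto simp: translates_def)
  ultimately obtain h where h: "h \<in> H" "(inv f \<otimes> a) <# C = h <# C" by auto
  have hc: "h \<in> carrier G" using h H by auto
  have "a <# C = (f \<otimes> h) <# C"
  proof -
    have "inv (inv f \<otimes> a) \<otimes> h \<in> C"
      using h lcoset_eq_iff[OF assms(3)] car hc by simp
    moreover have "inv (inv f \<otimes> a) \<otimes> h = inv a \<otimes> (f \<otimes> h)"
      using car hc by (simp add: inv_mult_group m_assoc)
    ultimately show ?thesis
      using lcoset_eq_iff[OF assms(3)] car hc by simp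
  qed
  with a f h show "X \<in> (\<lambda>(f, h). (f \<otimes> h) <# C) ` (F \<times> H)" by auto
qed

lemma finite_translates_trans:
  assumes "A \<subseteq> carrier G" "subgroup B G" "subgroup C G"
    and "finite (translates A B)" "finite (translates B C)"
  shows "finite (translates A C)"
proof -
  obtain F where F: "F \<subseteq> A" "finite F" "translates A B = (\<lambda>a. a <# B) ` F"
    using translates_transversal[OF assms(4)] by metis
  obtain H where H: "H \<subseteq> B" "finite H" "translates B C = (\<lambda>a. a <# C) ` H"
    using translates_transversal[OF assms(5)] by metis
  show ?thesis
    using translates_subset_mult[OF assms(1-3) F(1,3) H(1,3)] F(2) H(2)
    by (meson finite_SigmaI finite_imageI finite_subset)
qed

lemma index_triangle:
  assumes "A \<subseteq> carrier G" "subgroup B G" "subgroup C G"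
    and "finite (translates A B)" "finite (translates B C)"
  shows "index A C \<le> index A B * index B C"
proof -
  obtain F where F: "F \<subseteq> A" "finite F" "card F = index A B" "translates A B = (\<lambda>a. a <# B) ` F"
    using translates_transversal[OF assms(4)] by metis
  obtain H where H: "H \<subseteq> B" "finite H" "card H = index B C" "translates B C = (\<lambda>a. a <# C) ` H"
    using translates_transversal[OF assms(5)] by metis
  have "index A C \<le> card ((\<lambda>(f, h). (f \<otimes> h) <# C) ` (F \<times> H))"
    using translates_subset_mult[OF assms(1-3) F(1,4) H(1,4)] F H by (intro card_mono) auto
  also have "\<dots> \<le> card (F \<times> H)"
    using F H by (intro card_image_le) auto
  finally show ?thesis
    using F H by (simp add: card_cartesian_product)
qed

lemma index_tower:
  assumes "subgroup A G" "subgroup B G" "subgroup C G" "C \<subseteq> B" "B \<subseteq> A"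
    and "finite (translates A B)" "finite (translates B C)"
  shows "index A C = index A B * index B C"
proof -
  obtain F where F: "F \<subseteq> A" "finite F" "inj_on (\<lambda>a. a <# B) F" "card F = index A B"
      "translates A B = (\<lambda>a. a <# B) ` F"
    using translates_transversal[OF assms(6)] by metis
  obtain H where H: "H \<subseteq> B" "finite H" "inj_on (\<lambda>a. a <# C) H" "card H = index B C"
      "translates B C = (\<lambda>a. a <# C) ` H"
    using translates_transversal[OF assms(7)] by metis
  note sub = subgroup.subset[OF assms(1)] subgroup.subset[OF assms(2)] subgroup.subset[OF assms(3)]
  have Fc: "f \<in> carrier G" if "f \<in> F" for f using that F(1) sub by auto
  have Hc: "h \<in> carrier G" "h \<in> B" if "h \<in> H" for h using that H(1) sub by auto
  have "translates A C = (\<lambda>(f, h). (f \<otimes> h) <# C) ` (F \<times> H)"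
  proof
    show "translates A C \<subseteq> (\<lambda>(f, h). (f \<otimes> h) <# C) ` (F \<times> H)"
      using translates_subset_mult[OF sub(1) assms(2,3) F(1,5) H(1,5)] .
    show "(\<lambda>(f, h). (f \<otimes> h) <# C) ` (F \<times> H) \<subseteq> translates A C"
      using F(1) H(1) assms(5) subgroup.m_closed[OF assms(1)]
      by (force simp: translates_def)
  qed
  moreover have "inj_on (\<lambda>(f, h). (f \<otimes> h) <# C) (F \<times> H)"
  proof (rule inj_onI, clarify)
    fix f h f' h'
    assume m: "f \<in> F" "h \<in> H" "f' \<in> F" "h' \<in> H"
      and eq: "(f \<otimes> h) <# C = (f' \<otimes> h') <# C"
    note mc [simp] = Fc[OF m(1)] Fc[OF m(3)] Hc[OF m(2)] Hc[OF m(4)]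
    have i: "inv (f \<otimes> h) \<otimes> (f' \<otimes> h') \<in> C"
      using eq lcoset_eq_iff[OF assms(3)] by simp
    have e: "inv f \<otimes> f' = h \<otimes> (inv (f \<otimes> h) \<otimes> (f' \<otimes> h')) \<otimes> inv h'"
      by (simp add: inv_mult_group m_assoc mult_inv_cancel_left)
    have "inv f \<otimes> f' \<in> B"
      unfolding e using subgroup.m_closed[OF assms(2) subgroup.m_closed[OF assms(2)]
          subgroup.m_inv_closed[OF assms(2)]] i assms(4) mc by blast
    then have "f <# B = f' <# B"
      using lcoset_eq_iff[OF assms(2)] by simp
    then have ff: "f = f'"
      using F(3) m by (auto simp: inj_on_def)
    have "inv (f \<otimes> h) \<otimes> (f' \<otimes> h') = inv h \<otimes> h'"
      unfolding ff by (simp add: inv_mult_group m_assoc mult_inv_cancel_left)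
    with i have "h <# C = h' <# C"
      using lcoset_eq_iff[OF assms(3)] by simp
    then have "h = h'"
      using H(3) m by (auto simp: inj_on_def)
    with ff show "f = f' \<and> h = h'" by simp
  qed
  ultimately show ?thesis
    using F H by (simp add: card_image card_cartesian_product)
qed

lemma index_pos:
  assumes "finite (translates A B)" "A \<noteq> {}"
  shows "index A B > 0"
  using assms by (auto simp: translates_def card_gt_0_iff)

lemma index_eq_1_imp_subset:
  assumes "subgroup A G" "subgroup B G" "index A B = 1"
  shows "A \<subseteq> B"
proof
  fix a assume "a \<in> A"
  have "\<one> <# B \<in> translates A B" "a <# B \<in> translates A B"
    using \<open>a \<in> A\<close> subgroup.one_closed[OF assms(1)] by (auto simp: translates_def)
  then have "\<one> <# B = a <# B"
    using assms(3) card_1_singletonE by (metis One_nat_def singletonD)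
  then have "inv \<one> \<otimes> a \<in> B"
    using lcoset_eq_iff[OF assms(2)] subgroup.mem_carrier[OF assms(1) \<open>a \<in> A\<close>] by simp
  then show "a \<in> B"
    using subgroup.mem_carrier[OF assms(1) \<open>a \<in> A\<close>] by simp
qed

text \<open>A homomorphism maps the translates of \<open>B\<close> by \<open>A\<close> onto those of \<open>h(B)\<close> by \<open>h(A)\<close>.\<close>
lemma
  assumes "h \<in> hom G G" "A \<subseteq> carrier G" "B \<subseteq> carrier G"
  shows finite_translates_hom: "finite (translates A B) \<Longrightarrow> finite (translates (h ` A) (h ` B))"
    and index_hom_le: "finite (translates A B) \<Longrightarrow> index (h ` A) (h ` B) \<le> index A B"
proof -
  have "h ` (a <# B) = h a <# h ` B" if "a \<in> A" for a
    using that assms by (force simp: l_coset_def hom_mult)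
  then have "translates (h ` A) (h ` B) = image h ` translates A B"
    by (auto simp: translates_def image_image)
  then show "finite (translates A B) \<Longrightarrow> finite (translates (h ` A) (h ` B))"
    and "finite (translates A B) \<Longrightarrow> index (h ` A) (h ` B) \<le> index A B"
    by (auto intro: card_image_le)
qed


text \<open>Two translates of \<open>B\<close> by \<open>h(A)\<close> agree exactly when the corresponding translates of \<open>C\<close> by \<open>A\<close> do.
  In the application \<open>C\<close> is the preimage of \<open>B\<close>, cut down to \<open>A\<close>.\<close>
lemma index_hom_eq:
  assumes h: "h \<in> hom G G" and A: "A \<subseteq> carrier G" and B: "subgroup B G" and C: "subgroup C G"
    and BC: "\<And>a b. a \<in> A \<Longrightarrow> b \<in> A \<Longrightarrow> h (inv a \<otimes> b) \<in> B \<longleftrightarrow> inv a \<otimes> b \<in> C"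
  shows "index (h ` A) B = index A C"
proof -
  interpret h: group_hom G G h
    using h by (simp add: group_hom_def group_hom_axioms_def)
  have "h a <# B = h b <# B \<longleftrightarrow> a <# C = b <# C" if "a \<in> A" "b \<in> A" for a b
  proof -
    have "a \<in> carrier G" "b \<in> carrier G" using that A by auto
    then show ?thesis
      using lcoset_eq_iff[OF B] lcoset_eq_iff[OF C] BC[OF that] by simp
  qed
  from card_images_same_kernel[of A "\<lambda>a. h a <# B" "\<lambda>a. a <# C", OF this]
  show ?thesis
    by (simp add: translates_def image_image)
qed

lemma index_Int:
  assumes "subgroup A G" "subgroup B G"
  shows "index A (A \<inter> B) = index A B"
proof -
  have "a <# (A \<inter> B) = b <# (A \<inter> B) \<longleftrightarrow> a <# B = b <# B" if "a \<in> A" "b \<in> A" for a b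
    using that lcoset_eq_iff[OF assms(2)] lcoset_eq_iff[OF subgroups_Inter_pair[OF assms]]
      subgroup.m_closed[OF assms(1)] subgroup.m_inv_closed[OF assms(1)]
      subgroup.mem_carrier[OF assms(1)] by auto
  from card_images_same_kernel[of A "\<lambda>a. a <# (A \<inter> B)" "\<lambda>a. a <# B", OF this]
  show ?thesis
    unfolding translates_def .
qed

lemma subgroup_set_mult_if_normalizes:
  assumes N: "subgroup N G" and H: "subgroup H G"
    and conj: "\<And>h n. h \<in> H \<Longrightarrow> n \<in> N \<Longrightarrow> h \<otimes> n \<otimes> inv h \<in> N"
  shows "subgroup (N <#> H) G"
proof (rule subgroupI)
  note Nc = subgroup.mem_carrier[OF N] and Hc = subgroup.mem_carrier[OF H]
  show "N <#> H \<subseteq> carrier G"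
    using Nc Hc unfolding set_mult_def by auto
  show "N <#> H \<noteq> {}"
    using subgroup.one_closed[OF N] subgroup.one_closed[OF H] unfolding set_mult_def by blast
  show "inv a \<in> N <#> H" if a': "a \<in> N <#> H" for a
  proof -
    obtain n h where a: "n \<in> N" "h \<in> H" "a = n \<otimes> h" using a' unfolding set_mult_def by blast
    have "inv a = (inv h \<otimes> inv n \<otimes> inv (inv h)) \<otimes> inv h"
      using a Nc[OF a(1)] Hc[OF a(2)] by (simp add: inv_mult_group m_assoc)
    moreover have "inv h \<otimes> inv n \<otimes> inv (inv h) \<in> N"
      using a by (intro conj subgroup.m_inv_closed[OF N] subgroup.m_inv_closed[OF H])
    ultimately show ?thesis
      using subgroup.m_inv_closed[OF H a(2)] unfolding set_mult_def by blast
  qed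
  show "a \<otimes> b \<in> N <#> H" if a': "a \<in> N <#> H" and b': "b \<in> N <#> H" for a b
  proof -
    obtain n h where a: "n \<in> N" "h \<in> H" "a = n \<otimes> h" using a' unfolding set_mult_def by blast
    obtain m k where b: "m \<in> N" "k \<in> H" "b = m \<otimes> k" using b' unfolding set_mult_def by blast
    have "a \<otimes> b = (n \<otimes> (h \<otimes> m \<otimes> inv h)) \<otimes> (h \<otimes> k)"
      using a b Nc Hc by (simp add: m_assoc mult_inv_cancel_left)
    moreover have "n \<otimes> (h \<otimes> m \<otimes> inv h) \<in> N" "h \<otimes> k \<in> H"
      using a b conj subgroup.m_closed[OF N] subgroup.m_closed[OF H] by auto
    ultimately show ?thesis
      unfolding set_mult_def by blast
  qed
qed

end

section \<open>Compact open subgroups of topological groups\<close>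

context topological_group
begin

lemma openin_subset_carrier: "openin T S \<Longrightarrow> S \<subseteq> carrier G"
  using openin_subset topspace_eq by metis

lemma continuous_map_mult:
  assumes "continuous_map X T f" "continuous_map X T g"
  shows "continuous_map X T (\<lambda>x. f x \<otimes> g x)"
proof -
  have "continuous_map X (prod_topology T T) (\<lambda>x. (f x, g x))"
    using assms by (simp add: continuous_map_pairedI)
  from continuous_map_compose[OF this continuous_mult] show ?thesis
    by (simp add: o_def)
qed

lemma continuous_map_inv:
  "continuous_map X T f \<Longrightarrow> continuous_map X T (\<lambda>x. inv f x)"
  using continuous_map_compose[OF _ continuous_inv, of X f] by (simp add: o_def)

lemma continuous_map_const_carrier:
  "a \<in> carrier G \<Longrightarrow> continuous_map X T (\<lambda>x. a)"
  by (simp add: topspace_eq)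

lemma continuous_left_mult:
  assumes "a \<in> carrier G"
  shows "continuous_map T T (\<lambda>y. a \<otimes> y)"
  using continuous_map_mult[OF continuous_map_const_carrier[OF assms] continuous_map_id]
  by (simp add: o_def)

lemma lcoset_eq_preimage:
  assumes "S \<subseteq> carrier G" "a \<in> carrier G"
  shows "a <# S = {y \<in> topspace T. inv a \<otimes> y \<in> S}"
proof
  show "a <# S \<subseteq> {y \<in> topspace T. inv a \<otimes> y \<in> S}"
    using assms by (auto simp: l_coset_def topspace_eq mult_inv_cancel_left subset_iff)
  show "{y \<in> topspace T. inv a \<otimes> y \<in> S} \<subseteq> a <# S"
  proof
    fix y assume "y \<in> {y \<in> topspace T. inv a \<otimes> y \<in> S}"
    then have "y = a \<otimes> (inv a \<otimes> y)" "inv a \<otimes> y \<in> S"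
      using assms by (simp_all add: topspace_eq mult_inv_cancel_left)
    then show "y \<in> a <# S"
      unfolding l_coset_def by blast
  qed
qed

lemma openin_lcoset:
  assumes "openin T S" "a \<in> carrier G"
  shows "openin T (a <# S)"
  unfolding lcoset_eq_preimage[OF openin_subset_carrier[OF assms(1)] assms(2)]
  using assms by (intro openin_continuous_map_preimage[OF continuous_left_mult]) auto

lemma closedin_lcoset:
  assumes "closedin T S" "a \<in> carrier G"
  shows "closedin T (a <# S)"
proof -
  have "S \<subseteq> carrier G"
    using closedin_subset[OF assms(1)] topspace_eq by simp
  from lcoset_eq_preimage[OF this assms(2)] show ?thesis
    using closedin_continuous_map_preimage[OF continuous_left_mult assms(1)] assms(2) by simp
qed

lemma openin_subgroup_if_contains_open_subgroup:
  assumes "subgroup H G" "subgroup V G" "openin T V" "V \<subseteq> H"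
  shows "openin T H"
proof -
  have "\<exists>S. openin T S \<and> h \<in> S \<and> S \<subseteq> H" if "h \<in> H" for h
  proof (intro exI conjI)
    have hc: "h \<in> carrier G" using that subgroup.mem_carrier[OF assms(1)] by simp
    show "openin T (h <# V)" using openin_lcoset[OF assms(3) hc] .
    show "h \<in> h <# V" using lcos_self[OF hc assms(2)] .
    show "h <# V \<subseteq> H"
      using that assms(4) subgroup.m_closed[OF assms(1)] by (auto simp: l_coset_def)
  qed
  then show ?thesis
    using openin_subopen by blast
qed

lemma closedin_open_subgroup:
  assumes "subgroup H G" "openin T H"
  shows "closedin T H"
proof -
  have "\<exists>S. openin T S \<and> x \<in> S \<and> S \<subseteq> topspace T - H" if "x \<in> topspace T - H" for x
  proof (intro exI conjI)
    have xc: "x \<in> carrier G" using that topspace_eq by simp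
    show "openin T (x <# H)" using openin_lcoset[OF assms(2) xc] .
    show "x \<in> x <# H" using lcos_self[OF xc assms(1)] .
    have "y \<notin> H" if y: "y \<in> x <# H" for y
    proof
      assume "y \<in> H"
      obtain h where h: "h \<in> H" "y = x \<otimes> h" using y by (auto simp: l_coset_def)
      have hc: "h \<in> carrier G" using h subgroup.mem_carrier[OF assms(1)] by simp
      have "y \<otimes> inv h \<in> H"
        using \<open>y \<in> H\<close> h(1) subgroup.m_closed[OF assms(1)] subgroup.m_inv_closed[OF assms(1)] by simp
      then have "x \<in> H"
        using h hc xc by (simp add: m_assoc)
      with \<open>x \<in> topspace T - H\<close> show False by simp
    qed
    then show "x <# H \<subseteq> topspace T - H"
      using openin_subset[OF openin_lcoset[OF assms(2) xc]] by auto
  qed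
  then have "openin T (topspace T - H)"
    using openin_subopen by blast
  then show ?thesis
    using openin_subset_carrier[OF assms(2)] topspace_eq by (simp add: closedin_def)
qed

text \<open>Closedness of a subgroup can be tested near the identity: each translate \<open>xU\<close> either misses \<open>H\<close>
  or equals \<open>hU\<close> for some \<open>h \<in> H\<close>, and then it meets \<open>H\<close> in the closed set \<open>h(U \<inter> H)\<close>.\<close>
lemma closedin_subgroup_if_closedin_Int:
  assumes H: "subgroup H G" and U: "subgroup U G" "openin T U" and cl: "closedin T (U \<inter> H)"
  shows "closedin T H"
proof -
  have "\<exists>S. openin T S \<and> x \<in> S \<and> S \<subseteq> topspace T - H" if x: "x \<in> topspace T - H" for x
  proof -
    have xc: "x \<in> carrier G" using x topspace_eq by simp
    have op: "openin T (x <# U)" and self: "x \<in> x <# U"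
      using openin_lcoset[OF U(2) xc] lcos_self[OF xc U(1)] .
    show ?thesis
    proof (cases "(x <# U) \<inter> H = {}")
      case True
      then show ?thesis
        using op self openin_subset[OF op] by (intro exI[of _ "x <# U"]) auto
    next
      case False
      then obtain h where h: "h \<in> x <# U" "h \<in> H" by blast
      have hc: "h \<in> carrier G" using h subgroup.mem_carrier[OF H] by simp
      have eq: "x <# U = h <# U"
        using l_repr_independence[OF h(1) xc U(1)] .
      have int: "(h <# U) \<inter> H = h <# (U \<inter> H)"
      proof (intro equalityI subsetI)
        fix y assume y: "y \<in> (h <# U) \<inter> H"
        then obtain u where u: "u \<in> U" "y = h \<otimes> u" by (auto simp: l_coset_def)
        have "u = inv h \<otimes> y"
          using u hc subgroup.mem_carrier[OF U(1)] by (simp add: mult_inv_cancel_left)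
        then have "u \<in> H"
          using y h subgroup.m_closed[OF H] subgroup.m_inv_closed[OF H] by simp
        with u show "y \<in> h <# (U \<inter> H)" by (auto simp: l_coset_def)
      next
        fix y assume "y \<in> h <# (U \<inter> H)"
        then show "y \<in> (h <# U) \<inter> H"
          using h subgroup.m_closed[OF H] by (auto simp: l_coset_def)
      qed
      have "openin T ((h <# U) - (h <# (U \<inter> H)))"
        using openin_lcoset[OF U(2) hc] closedin_lcoset[OF cl hc] by (rule openin_diff)
      moreover have "x \<in> (h <# U) - (h <# (U \<inter> H))"
        using self eq int x by auto
      moreover have "(h <# U) - (h <# (U \<inter> H)) \<subseteq> topspace T - H"
        using int op eq openin_subset by fastforce
      ultimately show ?thesis by blast
    qed
  qed
  then have "openin T (topspace T - H)"
    using openin_subopen by blast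
  then show ?thesis
    using subgroup.subset[OF H] topspace_eq by (simp add: closedin_def)
qed

text \<open>The translates of \<open>U\<close> by \<open>K\<close> form an open cover of \<open>K\<close> by pairwise disjoint sets.\<close>
lemma finite_translates_compact_open:
  assumes "compactin T K" "subgroup U G" "openin T U"
  shows "finite (translates K U)"
proof -
  have K: "K \<subseteq> carrier G"
    using compactin_subset_topspace[OF assms(1)] topspace_eq by simp
  have "\<And>X. X \<in> translates K U \<Longrightarrow> openin T X"
    using K openin_lcoset[OF assms(3)] by (auto simp: translates_def)
  moreover have "K \<subseteq> \<Union>(translates K U)"
    using K lcos_self[OF _ assms(2)] by (auto simp: translates_def)
  ultimately obtain \<F> where F: "finite \<F>" "\<F> \<subseteq> translates K U" "K \<subseteq> \<Union>\<F>"
    using compactinD[OF assms(1)] by metis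
  have "translates K U \<subseteq> \<F>"
  proof
    fix X assume "X \<in> translates K U"
    then obtain a where a: "a \<in> K" "X = a <# U" by (auto simp: translates_def)
    then obtain Y where Y: "Y \<in> \<F>" "a \<in> Y" using F(3) by auto
    then obtain b where b: "b \<in> K" "Y = b <# U" using F(2) by (auto simp: translates_def)
    then have "Y = a <# U"
      using l_repr_independence[of a b U] Y K assms(2) by auto
    with a Y show "X \<in> \<F>" by simp
  qed
  with F(1) show ?thesis
    using finite_subset by blast
qed

lemma compact_open_subgroup_if_subset_compact:
  assumes "subgroup H G" "openin T H" "H \<subseteq> K" "compactin T K"
  shows "compact_open_subgroup G T H"
  using assms closed_compactin[OF assms(4,3)] closedin_open_subgroup
  by (auto simp: compact_open_subgroup_def)

end

text \<open>The diagonal is the preimage of \<open>{\<one>}\<close> under \<open>(x, y) \<mapsto> x\<^sup>-\<^sup>1 y\<close>.\<close>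
lemma (in topological_group) Hausdorff_if_t1:
  assumes "t1_space T"
  shows "Hausdorff_space T"
proof -
  have "closedin T {\<one>}"
    using assms topspace_eq by (simp add: t1_space_closedin_singleton)
  moreover have "continuous_map (prod_topology T T) T (\<lambda>p. inv fst p \<otimes> snd p)"
    by (intro continuous_map_mult continuous_map_inv continuous_map_fst continuous_map_snd)
  ultimately have "closedin (prod_topology T T)
      {p \<in> topspace (prod_topology T T). inv fst p \<otimes> snd p \<in> {\<one>}}"
    by (rule closedin_continuous_map_preimage[rotated])
  moreover have "{p \<in> topspace (prod_topology T T). inv fst p \<otimes> snd p \<in> {\<one>}}
      = (\<lambda>x. (x, x)) ` topspace T"
  proof -
    have "inv x \<otimes> y = \<one> \<longleftrightarrow> x = y" if "x \<in> carrier G" "y \<in> carrier G" for x y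
      using that by (metis inv_closed inv_inv inv_equality l_inv)
    then show ?thesis
      by (auto simp: topspace_eq)
  qed
  ultimately show ?thesis
    by (simp add: Hausdorff_space_closedin_diagonal)
qed

text \<open>The closure of a point is connected.\<close>
lemma totally_disconnected_imp_t1:
  assumes "totally_disconnected_space X"
  shows "t1_space X"
  unfolding t1_space_closedin_singleton
proof
  fix x assume x: "x \<in> topspace X"
  then have "connectedin X (X closure_of {x})"
    by (intro connectedin_closure_of) (simp add: connectedin_sing)
  then obtain a where "X closure_of {x} \<subseteq> {a}"
    using assms by (auto simp: totally_disconnected_space_def)
  moreover have "x \<in> X closure_of {x}"
    using x by (simp add: in_closure_of)
  ultimately have "X closure_of {x} = {x}" by auto
  then show "closedin X {x}"
    using closure_of_eq by metis
qed

lemma (in tdlc_group) Hausdorff: "Hausdorff_space T"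
  using Hausdorff_if_t1 totally_disconnected_imp_t1 totally_disconnected by blast

lemma compactin_nest_nonempty:
  fixes C :: "nat \<Rightarrow> 'a set"
  assumes "Hausdorff_space X" "\<And>n. compactin X (C n)" "\<And>n. C n \<noteq> {}"
    "\<And>n. C (Suc n) \<subseteq> C n"
  shows "(\<Inter>n. C n) \<noteq> {}"
proof (rule compact_space_imp_nest)
  have dec: "decseq C" using assms(4) by (simp add: decseq_Suc_iff)
  then show "decseq C" .
  show "compact_space (subtopology X (C 0))"
    using assms(2) compactin_subspace by blast
  show "closedin (subtopology X (C 0)) (C n)" for n
    using compactin_imp_closedin[OF assms(1,2)] dec
    by (intro closedin_subset_topspace) (auto simp: decseq_def)
qed (use assms(3) in auto)

section \<open>Orbits under an endomorphism\<close>

locale tdlc_endomorphism = tdlc_group G T for G (structure) and T +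
  fixes \<alpha> :: "'a \<Rightarrow> 'a"
  assumes continuous_endomorphism: "\<alpha> \<in> continuous_End G T"
begin

abbreviation pre :: "nat \<Rightarrow> 'a set \<Rightarrow> 'a set" where "pre \<equiv> preimage_pow G \<alpha>"
abbreviation neg :: "'a set \<Rightarrow> nat \<Rightarrow> 'a set" where "neg \<equiv> U_neg G \<alpha>"
abbreviation pos :: "'a set \<Rightarrow> nat \<Rightarrow> 'a set" where "pos \<equiv> U_pos \<alpha>"
abbreviation minus_part :: "'a set \<Rightarrow> 'a set" where "minus_part \<equiv> U_minus G \<alpha>"
abbreviation plus_part :: "'a set \<Rightarrow> 'a set" where "plus_part \<equiv> U_plus \<alpha>"
abbreviation minus_hull :: "'a set \<Rightarrow> 'a set" where "minus_hull \<equiv> U_minus_minus G \<alpha>"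
abbreviation compact_open :: "'a set \<Rightarrow> bool" where "compact_open \<equiv> compact_open_subgroup G T"

lemma pow_hom: "\<alpha> ^^ n \<in> hom G G"
proof (induction n)
  case 0
  show ?case by (simp add: hom_def)
next
  case (Suc n)
  have "\<alpha> \<in> hom G G"
    using continuous_endomorphism by (simp add: continuous_End_def)
  then show ?case
    using hom_mult[OF Suc] hom_mult[of \<alpha> G G] hom_in_carrier[OF Suc] hom_in_carrier[of \<alpha> G G]
    by (auto intro!: homI)
qed

sublocale pow: group_hom G G "\<alpha> ^^ n" for n
  using pow_hom by (simp add: group_hom_def group_hom_axioms_def)

lemma pow_closed [simp]: "x \<in> carrier G \<Longrightarrow> (\<alpha> ^^ n) x \<in> carrier G"
  by (rule pow.hom_closed)

lemma map_closed [simp]: "x \<in> carrier G \<Longrightarrow> \<alpha> x \<in> carrier G"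
  using pow_closed[of x 1] by simp

lemma map_mult: "x \<in> carrier G \<Longrightarrow> y \<in> carrier G \<Longrightarrow> \<alpha> (x \<otimes> y) = \<alpha> x \<otimes> \<alpha> y"
  using pow.hom_mult[of x y 1] by simp

lemma map_inv: "x \<in> carrier G \<Longrightarrow> \<alpha> (inv x) = inv \<alpha> x"
  using pow.hom_inv[of x 1] by simp

lemma pow_map: "(\<alpha> ^^ n) (\<alpha> x) = (\<alpha> ^^ Suc n) x"
  by (simp add: funpow_swap1)

lemma pow_pow: "(\<alpha> ^^ m) ((\<alpha> ^^ n) x) = (\<alpha> ^^ (m + n)) x"
  by (simp add: funpow_add)

lemma continuous_pow: "continuous_map T T (\<alpha> ^^ n)"
proof (induction n)
  case 0
  show ?case by (simp add: id_def[symmetric])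
next
  case (Suc n)
  then show ?case
    using continuous_endomorphism continuous_map_compose[OF Suc, of T \<alpha>]
    by (simp add: continuous_End_def o_def)
qed

lemma compact_openD:
  assumes "compact_open U"
  shows "subgroup U G" "compactin T U" "openin T U" "U \<subseteq> carrier G"
  using assms subgroup.subset by (auto simp: compact_open_subgroup_def)

lemma mem_pre: "x \<in> pre n S \<longleftrightarrow> x \<in> carrier G \<and> (\<alpha> ^^ n) x \<in> S"
  by (simp add: preimage_pow_def)

lemma mem_neg: "x \<in> neg U n \<longleftrightarrow> x \<in> carrier G \<and> (\<forall>k\<le>n. (\<alpha> ^^ k) x \<in> U)"
proof -
  have "x \<in> neg U n \<longleftrightarrow> (\<forall>k\<le>n. x \<in> pre k U)"
    by (auto simp: U_neg_def)
  then show ?thesis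
    unfolding mem_pre by blast
qed

lemma mem_minus_part: "x \<in> minus_part U \<longleftrightarrow> x \<in> carrier G \<and> (\<forall>k. (\<alpha> ^^ k) x \<in> U)"
proof -
  have "x \<in> minus_part U \<longleftrightarrow> (\<forall>n. x \<in> neg U n)"
    by (simp add: U_minus_def)
  then show ?thesis
    unfolding mem_neg by blast
qed

lemma mem_minus_hull: "x \<in> minus_hull U \<longleftrightarrow> x \<in> carrier G \<and> (\<exists>n. (\<alpha> ^^ n) x \<in> minus_part U)"
  by (auto simp: U_minus_minus_def mem_pre)

lemma neg_0: "U \<subseteq> carrier G \<Longrightarrow> neg U 0 = U"
  by (auto simp: mem_neg)

lemma neg_subset: "neg U n \<subseteq> U"
proof
  fix x assume "x \<in> neg U n"
  then have "(\<alpha> ^^ 0) x \<in> U" unfolding mem_neg by blast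
  then show "x \<in> U" by simp
qed

lemma neg_antimono: "m \<le> n \<Longrightarrow> neg U n \<subseteq> neg U m"
  using order_trans unfolding subset_iff mem_neg by blast

lemma neg_Suc: "neg U (Suc n) = neg U n \<inter> pre (Suc n) U"
  unfolding set_eq_iff Int_iff mem_neg mem_pre le_Suc_eq by blast

lemma neg_neg: "neg (neg U m) n = neg U (m + n)"
proof -
  have "(\<forall>k\<le>n. \<forall>j\<le>m. (\<alpha> ^^ (j + k)) x \<in> U) \<longleftrightarrow> (\<forall>k\<le>m + n. (\<alpha> ^^ k) x \<in> U)" for x
  proof (intro iffI allI impI)
    fix k assume h: "\<forall>k\<le>n. \<forall>j\<le>m. (\<alpha> ^^ (j + k)) x \<in> U" and k: "k \<le> m + n"
    have "min k m + (k - min k m) = k" "k - min k m \<le> n" "min k m \<le> m"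
      using k by auto
    then show "(\<alpha> ^^ k) x \<in> U" using h by metis
  qed auto
  then show ?thesis
    by (auto simp: mem_neg pow_pow)
qed

lemma map_neg_Suc:
  assumes "x \<in> neg U (Suc n)"
  shows "\<alpha> x \<in> neg U n"
proof -
  have "(\<alpha> ^^ k) (\<alpha> x) \<in> U" if "k \<le> n" for k
    using assms that Suc_le_mono unfolding pow_map mem_neg by blast
  moreover have "x \<in> carrier G"
    using assms mem_neg by blast
  ultimately show ?thesis
    by (simp add: mem_neg)
qed

text \<open>Consequently the displacement index of \<open>U\<^sub>-\<^sub>n\<close> is \<open>[U\<^sub>-\<^sub>n : U\<^sub>-\<^sub>n\<^sub>-\<^sub>1]\<close>.\<close>
lemma neg_Int_pre: "neg U n \<inter> pre 1 (neg U n) = neg U (Suc n)"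
proof (intro equalityI subsetI)
  fix x assume "x \<in> neg U n \<inter> pre 1 (neg U n)"
  then have "x \<in> neg U n" "\<alpha> x \<in> neg U n"
    by (simp_all add: mem_pre)
  then have "x \<in> neg U n" "(\<alpha> ^^ n) (\<alpha> x) \<in> U"
    unfolding mem_neg by blast+
  then show "x \<in> neg U (Suc n)"
    unfolding pow_map neg_Suc Int_iff mem_pre mem_neg by blast
next
  fix x assume x: "x \<in> neg U (Suc n)"
  then have "x \<in> neg U n"
    using neg_antimono[of n "Suc n" U] by auto
  moreover have "x \<in> carrier G"
    using x mem_neg by blast
  ultimately show "x \<in> neg U n \<inter> pre 1 (neg U n)"
    using map_neg_Suc[OF x] by (simp add: mem_pre)
qed

lemma subgroup_pre:
  assumes "subgroup S G"
  shows "subgroup (pre n S) G"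
proof (rule subgroupI)
  have "\<one> \<in> pre n S"
    using subgroup.one_closed[OF assms] by (simp add: mem_pre)
  then show "pre n S \<noteq> {}" by blast
qed (use subgroup.m_closed[OF assms] subgroup.m_inv_closed[OF assms] in \<open>auto simp: mem_pre\<close>)

lemma openin_pre: "openin T S \<Longrightarrow> openin T (pre n S)"
  using openin_continuous_map_preimage[OF continuous_pow, of S n]
  by (simp add: preimage_pow_def topspace_eq)

lemma closedin_pre: "closedin T S \<Longrightarrow> closedin T (pre n S)"
  using closedin_continuous_map_preimage[OF continuous_pow, of S n]
  by (simp add: preimage_pow_def topspace_eq)

lemma compact_open_Int:
  assumes "compact_open U" "subgroup H G" "openin T H"
  shows "compact_open (U \<inter> H)"
  using compact_openD(1-3)[OF assms(1)] assms(2,3)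
  by (intro compact_open_subgroup_if_subset_compact[where K = U] openin_Int subgroups_Inter_pair)
    simp_all

lemma compact_open_neg:
  assumes "compact_open U"
  shows "compact_open (neg U n)"
proof (induction n)
  case 0
  then show ?case
    using assms neg_0 compact_openD(4) by simp
next
  case (Suc n)
  then show ?case
    unfolding neg_Suc using compact_openD[OF assms] compact_open_Int subgroup_pre openin_pre by blast
qed

lemma subgroup_minus_part:
  assumes "subgroup U G"
  shows "subgroup (minus_part U) G"
proof (rule subgroupI)
  have "\<one> \<in> minus_part U"
    using subgroup.one_closed[OF assms] by (simp add: mem_minus_part)
  then show "minus_part U \<noteq> {}" by blast
qed (use subgroup.m_closed[OF assms] subgroup.m_inv_closed[OF assms] in \<open>auto simp: mem_minus_part\<close>)

lemma minus_part_subset: "minus_part U \<subseteq> U"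
proof
  fix x assume "x \<in> minus_part U"
  then have "(\<alpha> ^^ 0) x \<in> U" unfolding mem_minus_part by blast
  then show "x \<in> U" by simp
qed

lemma pow_mem_minus_part: "x \<in> minus_part U \<Longrightarrow> (\<alpha> ^^ n) x \<in> minus_part U"
  by (auto simp: mem_minus_part pow_pow)

lemma subgroup_minus_hull:
  assumes "subgroup U G"
  shows "subgroup (minus_hull U) G"
proof (rule subgroupI)
  note sub = subgroup_minus_part[OF assms]
  show "minus_hull U \<subseteq> carrier G" by (auto simp: mem_minus_hull)
  have "\<one> \<in> minus_hull U"
    using subgroup.one_closed[OF sub] by (auto simp: mem_minus_hull)
  then show "minus_hull U \<noteq> {}" by blast
  show "inv a \<in> minus_hull U" if "a \<in> minus_hull U" for a
    using that subgroup.m_inv_closed[OF sub] by (auto simp: mem_minus_hull)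
  show "a \<otimes> b \<in> minus_hull U" if a: "a \<in> minus_hull U" and b: "b \<in> minus_hull U" for a b
  proof -
    obtain m n where mn: "(\<alpha> ^^ m) a \<in> minus_part U" "(\<alpha> ^^ n) b \<in> minus_part U"
      using a b by (auto simp: mem_minus_hull)
    have "(\<alpha> ^^ (n + m)) a \<in> minus_part U" "(\<alpha> ^^ (m + n)) b \<in> minus_part U"
      using pow_mem_minus_part[OF mn(1), of n] pow_mem_minus_part[OF mn(2), of m] by (simp_all add: pow_pow)
    then have "(\<alpha> ^^ (m + n)) (a \<otimes> b) \<in> minus_part U"
      using a b subgroup.m_closed[OF sub] by (auto simp: mem_minus_hull add.commute)
    then show ?thesis
      using a b by (auto simp: mem_minus_hull)
  qed
qed

text \<open>Both sides consist of the end points of the orbit segments of length \<open>n\<close> inside \<open>U\<close>.\<close>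
lemma pos_eq_image_neg: "U \<subseteq> carrier G \<Longrightarrow> pos U n = (\<alpha> ^^ n) ` neg U n"
proof (induction n)
  case 0
  then show ?case by (auto simp: neg_0)
next
  case (Suc n)
  have "U \<inter> \<alpha> ` (\<alpha> ^^ n) ` neg U n = (\<alpha> ^^ Suc n) ` neg U (Suc n)"
    by (auto simp: neg_Suc mem_pre mem_neg image_iff)
  then show ?case
    using Suc by simp
qed

lemma pos_Suc_subset: "pos U (Suc n) \<subseteq> pos U n"
proof (induction n)
  case (Suc n)
  then show ?case
    using image_mono[OF Suc, of \<alpha>] by (simp only: U_pos.simps) blast
qed simp

lemma pos_subset: "pos U n \<subseteq> U"
  by (cases n) simp_all

lemma mem_plus_part: "x \<in> plus_part U \<longleftrightarrow> (\<forall>n. x \<in> pos U n)"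
  by (simp add: U_plus_def)

lemma plus_part_subset: "plus_part U \<subseteq> U"
  using pos_subset mem_plus_part by blast

lemma subgroup_image_pow: "subgroup S G \<Longrightarrow> subgroup ((\<alpha> ^^ n) ` S) G"
  using pow.subgroup_img_is_subgroup .

lemma compactin_pos: "compact_open U \<Longrightarrow> compactin T (pos U n)"
  using image_compactin[OF compact_openD(2)[OF compact_open_neg] continuous_pow] pos_eq_image_neg[OF compact_openD(4)]
  by simp

lemma subgroup_plus_part:
  assumes "compact_open U"
  shows "subgroup (plus_part U) G"
proof -
  have "subgroup (pos U n) G" for n
    using assms compact_openD compact_open_neg subgroup_image_pow pos_eq_image_neg by metis
  then show ?thesis
    unfolding U_plus_def by (intro subgroups_Inter) auto
qed

lemma map_mem_plus_part: "x \<in> plus_part U \<Longrightarrow> \<alpha> x \<in> U \<Longrightarrow> \<alpha> x \<in> plus_part U"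
proof -
  assume x: "x \<in> plus_part U" "\<alpha> x \<in> U"
  have "\<alpha> x \<in> pos U n" for n
    using x by (cases n) (auto simp: U_plus_def)
  then show ?thesis by (simp add: U_plus_def)
qed

text \<open>A point \<open>x\<close> of \<open>U\<^sub>+\<close> has a preimage in every \<open>U\<^sub>n\<close>; compactness of the sets \<open>U\<^sub>n \<inter> \<alpha>\<^sup>-\<^sup>1(x)\<close> yields one
  in all of them.\<close>
lemma plus_part_subset_image:
  assumes U: "compact_open U"
  shows "plus_part U \<subseteq> \<alpha> ` plus_part U"
proof
  fix x assume x: "x \<in> plus_part U"
  define C where "C n = pos U n \<inter> pre 1 {x}" for n
  have xc: "x \<in> topspace T"
    using x plus_part_subset compact_openD(4)[OF U] topspace_eq by auto
  have "closedin T {x}"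
    using xc totally_disconnected_imp_t1[OF totally_disconnected]
    by (simp add: t1_space_closedin_singleton)
  then have "compactin T (C n)" for n
    unfolding C_def using compactin_pos[OF U] closedin_pre
    by (intro compact_Int_closedin)
  moreover have "C n \<noteq> {}" for n
  proof -
    have "x \<in> pos U (Suc n)"
      using x mem_plus_part by blast
    then obtain y where "y \<in> pos U n" "x = \<alpha> y" by auto
    moreover from this have "y \<in> carrier G"
      using pos_subset compact_openD(4)[OF U] by blast
    ultimately show ?thesis by (auto simp: C_def mem_pre)
  qed
  moreover have "C (Suc n) \<subseteq> C n" for n
    using pos_Suc_subset by (auto simp: C_def)
  ultimately have "(\<Inter>n. C n) \<noteq> {}"
    by (rule compactin_nest_nonempty[OF Hausdorff])
  then obtain y where "\<And>n. y \<in> C n" by blast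
  then have "\<And>n. y \<in> pos U n" "x = \<alpha> y"
    unfolding C_def by (auto simp: mem_pre)
  then have "y \<in> plus_part U" "x = \<alpha> y"
    by (simp_all only: mem_plus_part simp_thms)
  then show "x \<in> \<alpha> ` plus_part U" by blast
qed

text \<open>Going back along preimages in \<open>M\<close> produces arbitrarily long pasts inside \<open>M\<close>.\<close>
lemma backward_orbit:
  assumes "M \<subseteq> \<alpha> ` M" "x \<in> M"
  shows "\<exists>y\<in>M. (\<alpha> ^^ n) y = x \<and> (\<forall>j\<le>n. (\<alpha> ^^ j) y \<in> M)"
proof (induction n)
  case 0
  then show ?case using assms(2) by auto
next
  case (Suc n)
  then obtain y where y: "y \<in> M" "(\<alpha> ^^ n) y = x" "\<forall>j\<le>n. (\<alpha> ^^ j) y \<in> M" by blast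
  then obtain z where z: "z \<in> M" "y = \<alpha> z" using assms(1) by auto
  have "(\<alpha> ^^ j) z \<in> M" if "j \<le> Suc n" for j
    using that y z by (cases j) (auto simp: pow_map[symmetric] simp del: funpow.simps)
  with y z show ?case
    by (intro bexI[of _ z]) (auto simp: pow_map)
qed

section \<open>Displacement indices\<close>

definition displacement :: "nat \<Rightarrow> 'a set \<Rightarrow> nat" where
  "displacement n W = index ((\<alpha> ^^ n) ` W) W"

text \<open>A multiplicative subgroup realizes the bound \<open>d\<^sub>n(W) \<le> d\<^sub>1(W)\<^sup>n\<close>, valid for all compact open
  subgroups, for every \<open>n\<close>.\<close>
definition multiplicative :: "'a set \<Rightarrow> bool" where
  "multiplicative W \<longleftrightarrow> (\<forall>n. displacement n W = displacement 1 W ^ n)"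

lemma multiplicativeD: "multiplicative W \<Longrightarrow> displacement n W = displacement 1 W ^ n"
  unfolding multiplicative_def by blast

lemma finite_translates_image_pow:
  assumes "compact_open W" "compact_open V"
  shows "finite (translates ((\<alpha> ^^ n) ` W) V)"
  using finite_translates_compact_open[OF image_compactin[OF compact_openD(2)[OF assms(1)] continuous_pow]
      compact_openD(1,3)[OF assms(2)]] .

lemma finite_translates_between_compact_open:
  assumes "compact_open W" "compact_open V"
  shows "finite (translates W V)"
  using finite_translates_compact_open[OF compact_openD(2)[OF assms(1)] compact_openD(1,3)[OF assms(2)]] .

lemma displacement_index_eq:
  assumes "compact_open W"
  shows "displacement_index G \<alpha> W = displacement 1 W"
proof -
  have sub: "subgroup (\<alpha> ` W) G"
    using subgroup_image_pow[OF compact_openD(1)[OF assms], of 1] by simp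
  have "(lcosets\<^bsub>G\<lparr>carrier := \<alpha> ` W\<rparr>\<^esub> (\<alpha> ` W \<inter> W)) = translates (\<alpha> ` W) (\<alpha> ` W \<inter> W)"
    by (auto simp: LCOSETS_def translates_def)
  then show ?thesis
    using index_Int[OF sub compact_openD(1)[OF assms]]
    by (simp add: displacement_index_def subgroup_index_def displacement_def)
qed

lemma displacement_eq_index:
  assumes "compact_open W"
  shows "displacement n W = index W (W \<inter> pre n W)"
proof -
  note W = compact_openD[OF assms]
  show ?thesis
    unfolding displacement_def
    using W subgroups_Inter_pair[OF W(1) subgroup_pre[OF W(1)]]
      subgroup.m_closed[OF W(1)] subgroup.m_inv_closed[OF W(1)]
    by (intro index_hom_eq[OF pow_hom]) (auto simp: mem_pre)
qed

lemma displacement_pos: "compact_open W \<Longrightarrow> displacement n W > 0"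
  unfolding displacement_def
  using finite_translates_image_pow[of W W n] subgroup.one_closed[OF compact_openD(1)]
  by (intro index_pos) auto

text \<open>The group \<open>\<alpha>\<^sup>m(W)\<close> is covered by \<open>d\<^sub>m(W)\<close> translates of \<open>W\<close>, so \<open>\<alpha>\<^sup>m\<^sup>+\<^sup>n(W)\<close> is covered by as many translates
  of \<open>\<alpha>\<^sup>n(W)\<close>, each of which is covered by \<open>d\<^sub>n(W)\<close> translates of \<open>W\<close>.\<close>
lemma displacement_add_le:
  assumes "compact_open W"
  shows "displacement (m + n) W \<le> displacement m W * displacement n W"
proof -
  note W = compact_openD[OF assms]
  have car: "(\<alpha> ^^ n) ` W \<subseteq> carrier G" for n
    using W(4) by auto
  have im: "(\<alpha> ^^ (m + n)) ` W = (\<alpha> ^^ n) ` (\<alpha> ^^ m) ` W"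
    by (simp add: image_image pow_pow add.commute)
  note fin = finite_translates_image_pow[OF assms assms]
  note step = finite_translates_hom[OF pow_hom car W(4) fin] index_hom_le[OF pow_hom car W(4) fin]
  have "displacement (m + n) W
      \<le> index ((\<alpha> ^^ n) ` (\<alpha> ^^ m) ` W) ((\<alpha> ^^ n) ` W) * displacement n W"
    unfolding displacement_def im
    using car[of "m + n"] W step(1) fin
    by (intro index_triangle subgroup_image_pow) (auto simp: im)
  also have "\<dots> \<le> displacement m W * displacement n W"
    unfolding displacement_def using step(2) by (intro mult_right_mono) auto
  finally show ?thesis .
qed

lemma displacement_0: "compact_open W \<Longrightarrow> displacement 0 W = 1"
proof -
  assume "compact_open W"
  note W = compact_openD[OF this]
  have "x <# W = \<one> <# W" if "x \<in> W" for x
    using that W subgroup.m_inv_closed[OF W(1)] subgroup.one_closed[OF W(1)]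
    by (subst lcoset_eq_iff) auto
  then have "translates W W = (\<lambda>x. \<one> <# W) ` W"
    unfolding translates_def by (rule image_cong[OF refl])
  then have "translates W W = {\<one> <# W}"
    using subgroup.one_closed[OF W(1)] by auto
  then show ?thesis by (simp add: displacement_def)
qed

lemma displacement_mult_le:
  assumes "compact_open W"
  shows "displacement (m * n) W \<le> displacement m W ^ n"
proof (induction n)
  case 0
  then show ?case using displacement_0[OF assms] by simp
next
  case (Suc n)
  have "displacement (m * Suc n) W \<le> displacement m W * displacement (m * n) W"
    using displacement_add_le[OF assms, of m "m * n"] by simp
  also have "\<dots> \<le> displacement m W * displacement m W ^ n"
    using Suc by simp
  finally show ?case by simp
qed

text \<open>The growth rate of \<open>d\<^sub>n\<close> depends on the endomorphism alone. Apply the triangle inequality along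
  \<open>\<alpha>\<^sup>n(W)\<close>, \<open>\<alpha>\<^sup>n(V)\<close>, \<open>V\<close>, \<open>W\<close>; the first step costs at most \<open>[W : W \<inter> V]\<close>, whatever \<open>n\<close> is.\<close>
lemma displacement_comparable:
  assumes "compact_open W" "compact_open V"
  shows "displacement n W \<le> (index W V * index V W) * displacement n V"
proof -
  note W = compact_openD[OF assms(1)] and V = compact_openD[OF assms(2)]
  have car: "(\<alpha> ^^ n) ` W \<subseteq> carrier G" "(\<alpha> ^^ n) ` V \<subseteq> carrier G"
    using W(4) V(4) by auto
  have 1: "displacement n W \<le> index ((\<alpha> ^^ n) ` W) V * index V W"
    unfolding displacement_def
    using car W V finite_translates_image_pow finite_translates_between_compact_open assms
    by (intro index_triangle) auto
  have 2: "index ((\<alpha> ^^ n) ` W) V \<le> index ((\<alpha> ^^ n) ` W) ((\<alpha> ^^ n) ` V) * displacement n V"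
    unfolding displacement_def
    using car W V finite_translates_image_pow finite_translates_between_compact_open assms subgroup_image_pow
      finite_translates_hom[OF pow_hom]
    by (intro index_triangle) auto
  have 3: "index ((\<alpha> ^^ n) ` W) ((\<alpha> ^^ n) ` V) \<le> index W V"
    using W V finite_translates_between_compact_open[OF assms] by (intro index_hom_le[OF pow_hom])
  have "displacement n W \<le> (index W V * displacement n V) * index V W"
    using order_trans[OF 1 mult_right_mono[OF order_trans[OF 2 mult_right_mono[OF 3]]]] by simp
  then show ?thesis by (simp add: mult.commute mult.left_commute)
qed

lemma multiplicative_minimal:
  assumes "compact_open W" "multiplicative W" "compact_open V"
  shows "displacement 1 W \<le> displacement 1 V"
proof (rule pow_le_const_mult_pow_imp_le)
  fix n
  have "displacement 1 W ^ n = displacement n W"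
    by (rule multiplicativeD[OF assms(2), symmetric])
  also have "\<dots> \<le> (index W V * index V W) * displacement n V"
    by (rule displacement_comparable[OF assms(1,3)])
  also have "\<dots> \<le> (index W V * index V W) * displacement 1 V ^ n"
    using displacement_mult_le[OF assms(3), of 1 n] by simp
  finally show "displacement 1 W ^ n \<le> (index W V * index V W) * displacement 1 V ^ n" .
qed

text \<open>If \<open>d\<^sub>k(V) < d\<^sub>1(V)\<^sup>k\<close> for a single \<open>k\<close>, submultiplicativity makes \<open>d\<^sub>k\<^sub>n(V)\<close> grow at a strictly smaller
  exponential rate than \<open>d\<^sub>1(V)\<^sup>k\<^sup>n = d\<^sub>1(W)\<^sup>k\<^sup>n = d\<^sub>k\<^sub>n(W)\<close>, although the two are comparable.\<close>
lemma multiplicative_if_minimal: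
  assumes "compact_open W" "multiplicative W" "compact_open V" "displacement 1 V = displacement 1 W"
  shows "multiplicative V"
  unfolding multiplicative_def
proof
  fix k
  have "displacement 1 V ^ k \<le> displacement k V"
  proof (rule pow_le_const_mult_pow_imp_le)
    fix n
    have "(displacement 1 V ^ k) ^ n = displacement (k * n) W"
      unfolding assms(4) power_mult[symmetric] by (rule multiplicativeD[OF assms(2), symmetric])
    also have "\<dots> \<le> (index W V * index V W) * displacement (k * n) V"
      by (rule displacement_comparable[OF assms(1,3)])
    also have "\<dots> \<le> (index W V * index V W) * displacement k V ^ n"
      using displacement_mult_le[OF assms(3)] by simp
    finally show "(displacement 1 V ^ k) ^ n \<le> (index W V * index V W) * displacement k V ^ n" .
  qed
  then show "displacement k V = displacement 1 V ^ k"
    using displacement_mult_le[OF assms(3), of 1 k] by simp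
qed

section \<open>Characterizations of multiplicativity\<close>

lemma displacement_neg_eq_index:
  assumes "compact_open U"
  shows "displacement 1 (neg U k) = index (neg U k) (neg U (Suc k))"
  using displacement_eq_index[OF compact_open_neg[OF assms], of 1 k] by (simp only: neg_Int_pre)

text \<open>The index \<open>d\<^sub>1(U\<^sub>-\<^sub>k\<^sub>-\<^sub>1)\<close> counts the translates of \<open>U\<^sub>-\<^sub>k\<^sub>-\<^sub>1\<close> by \<open>\<alpha>(U\<^sub>-\<^sub>k\<^sub>-\<^sub>1)\<close>, while \<open>d\<^sub>1(U\<^sub>-\<^sub>k)\<close> counts those by
  the larger set \<open>U\<^sub>-\<^sub>k\<close>.\<close>
lemma displacement_neg_Suc_le:
  assumes U: "compact_open U"
  shows "displacement 1 (neg U (Suc k)) \<le> displacement 1 (neg U k)"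
    and "displacement 1 (neg U (Suc k)) = displacement 1 (neg U k)
      \<Longrightarrow> translates (\<alpha> ` neg U (Suc k)) (neg U (Suc k)) = translates (neg U k) (neg U (Suc k))"
proof -
  have sub: "translates (\<alpha> ` neg U (Suc k)) (neg U (Suc k)) \<subseteq> translates (neg U k) (neg U (Suc k))"
    using map_neg_Suc by (auto simp: translates_def)
  have fin: "finite (translates (neg U k) (neg U (Suc k)))"
    using finite_translates_between_compact_open[OF compact_open_neg[OF U] compact_open_neg[OF U]] .
  have eq: "displacement 1 (neg U (Suc k)) = index (\<alpha> ` neg U (Suc k)) (neg U (Suc k))"
    by (simp add: displacement_def)
  show "displacement 1 (neg U (Suc k)) \<le> displacement 1 (neg U k)"
    unfolding eq displacement_neg_eq_index[OF U, of k] using card_mono[OF fin sub] .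
  show "translates (\<alpha> ` neg U (Suc k)) (neg U (Suc k)) = translates (neg U k) (neg U (Suc k))"
    if "displacement 1 (neg U (Suc k)) = displacement 1 (neg U k)"
    using that card_subset_eq[OF fin sub] unfolding eq displacement_neg_eq_index[OF U, of k] by blast
qed

text \<open>The right-hand side says \<open>U\<^sub>-\<^sub>k = \<alpha>(U\<^sub>-\<^sub>k\<^sub>-\<^sub>1) U\<^sub>-\<^sub>k\<^sub>-\<^sub>1\<close>.\<close>
lemma displacement_neg_eq_iff:
  assumes U: "compact_open U"
  shows "displacement 1 (neg U (Suc k)) = displacement 1 (neg U k) \<longleftrightarrow>
    (\<forall>x\<in>neg U k. \<exists>y\<in>neg U (Suc k). inv (\<alpha> y) \<otimes> x \<in> neg U (Suc k))"
    (is "?eq \<longleftrightarrow> ?fac")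
proof -
  note N = compact_openD[OF compact_open_neg[OF U]]
  have cos: "\<alpha> y <# neg U (Suc k) = x <# neg U (Suc k) \<longleftrightarrow> inv (\<alpha> y) \<otimes> x \<in> neg U (Suc k)"
    if "x \<in> neg U k" "y \<in> neg U (Suc k)" for x y
    using that subsetD[OF N(4)] by (intro lcoset_eq_iff[OF N(1)] map_closed) blast+
  show ?thesis
  proof
    assume ?eq
    note tr = displacement_neg_Suc_le(2)[OF U this]
    show ?fac
    proof
      fix x assume x: "x \<in> neg U k"
      then have "x <# neg U (Suc k) \<in> translates (\<alpha> ` neg U (Suc k)) (neg U (Suc k))"
        unfolding tr by (simp add: translates_def)
      then obtain y where "y \<in> neg U (Suc k)" "\<alpha> y <# neg U (Suc k) = x <# neg U (Suc k)"
        by (auto simp: translates_def)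
      with cos[OF x] show "\<exists>y\<in>neg U (Suc k). inv (\<alpha> y) \<otimes> x \<in> neg U (Suc k)" by blast
    qed
  next
    assume fac: ?fac
    have "translates (neg U k) (neg U (Suc k)) \<subseteq> translates (\<alpha> ` neg U (Suc k)) (neg U (Suc k))"
    proof
      fix X assume "X \<in> translates (neg U k) (neg U (Suc k))"
      then obtain x where x: "x \<in> neg U k" "X = x <# neg U (Suc k)"
        by (auto simp: translates_def)
      then obtain y where y: "y \<in> neg U (Suc k)" "inv (\<alpha> y) \<otimes> x \<in> neg U (Suc k)"
        using fac by blast
      have "X = \<alpha> y <# neg U (Suc k)"
        unfolding x(2) by (rule iffD2[OF cos[OF x(1) y(1)] y(2), symmetric])
      then show "X \<in> translates (\<alpha> ` neg U (Suc k)) (neg U (Suc k))"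
        using y(1) unfolding translates_def by blast
    qed
    from card_mono[OF _ this] have "displacement 1 (neg U k) \<le> displacement 1 (neg U (Suc k))"
      using finite_translates_image_pow[OF compact_open_neg[OF U] compact_open_neg[OF U], of 1]
      by (simp add: displacement_neg_eq_index[OF U, symmetric]) (simp add: displacement_def)
    with displacement_neg_Suc_le(1)[OF U] show ?eq
      by (rule antisym)
  qed
qed

lemma displacement_neg_antimono:
  assumes "compact_open U"
  shows "displacement 1 (neg U k) \<le> displacement 1 U"
  using displacement_neg_Suc_le(1)[OF assms] neg_0[OF compact_openD(4)[OF assms]]
  by (induction k) (auto intro: order_trans simp del: One_nat_def)

lemma index_neg_eq_prod:
  assumes U: "compact_open U"
  shows "index U (neg U n) = (\<Prod>k<n. displacement 1 (neg U k))"
proof (induction n)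
  case 0
  have "index U U = 1"
    using displacement_0[OF U] by (simp add: displacement_def)
  then show ?case
    using neg_0[OF compact_openD(4)[OF U]] by simp
next
  case (Suc n)
  have "index U (neg U (Suc n)) = index U (neg U n) * index (neg U n) (neg U (Suc n))"
    using compact_openD(1)[OF U] compact_openD(1)[OF compact_open_neg[OF U]] neg_subset neg_antimono[of n "Suc n"]
      finite_translates_between_compact_open compact_open_neg[OF U] U
    by (intro index_tower) auto
  then show ?case
    using Suc displacement_neg_eq_index[OF U] by simp
qed

text \<open>Here \<open>d\<^sub>n(U) = [U : U \<inter> \<alpha>\<^sup>-\<^sup>n(U)]\<close> is compared with the index of the smaller subgroup \<open>U\<^sub>-\<^sub>n\<close>, whose
  elements are in \<open>U\<close> at all times from \<open>0\<close> to \<open>n\<close> and not only at both ends.\<close>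
lemma displacement_le_index_neg:
  assumes U: "compact_open U"
  shows "displacement n U \<le> index U (neg U n)"
    and "displacement n U = index U (neg U n) \<Longrightarrow> U \<inter> pre n U = neg U n"
proof -
  note S = compact_openD[OF U] and N = compact_openD[OF compact_open_neg[OF U, of n]]
  have P: "compact_open (U \<inter> pre n U)"
    using compact_open_Int[OF U subgroup_pre[OF S(1)] openin_pre[OF S(3)]] .
  have sub: "neg U n \<subseteq> U \<inter> pre n U"
    by (auto simp: mem_pre mem_neg dest: subsetD[OF neg_subset])
  have tower: "index U (neg U n) = displacement n U * index (U \<inter> pre n U) (neg U n)"
    unfolding displacement_eq_index[OF U] using compact_openD(1)[OF P] S N sub
      finite_translates_between_compact_open[OF U P] finite_translates_between_compact_open[OF P compact_open_neg[OF U]]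
    by (intro index_tower) auto
  have pos: "index (U \<inter> pre n U) (neg U n) > 0"
    using finite_translates_between_compact_open[OF P compact_open_neg[OF U]] subgroup.one_closed[OF compact_openD(1)[OF P]]
    by (intro index_pos) blast+
  then show "displacement n U \<le> index U (neg U n)"
    unfolding tower by simp
  assume "displacement n U = index U (neg U n)"
  with tower displacement_pos[OF U, of n] have "index (U \<inter> pre n U) (neg U n) = 1"
    by simp
  with sub show "U \<inter> pre n U = neg U n"
    using index_eq_1_imp_subset[OF compact_openD(1)[OF P] N(1)] by blast
qed

text \<open>Multiplicativity is equality in both steps of \<open>d\<^sub>n(U) \<le> [U : U\<^sub>-\<^sub>n] = \<Prod>k<n. d\<^sub>1(U\<^sub>-\<^sub>k) \<le> d\<^sub>1(U)\<^sup>n\<close>.\<close>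
lemma multiplicative_iff:
  assumes U: "compact_open U"
  shows "multiplicative U \<longleftrightarrow> (\<forall>n. U \<inter> pre n U = neg U n) \<and>
    (\<forall>k. displacement 1 (neg U k) = displacement 1 U)"
    (is "_ \<longleftrightarrow> ?int \<and> ?const")
proof
  let ?d = "displacement 1 U"
  assume m: "multiplicative U"
  have le: "(\<Prod>k<n. displacement 1 (neg U k)) \<le> ?d ^ n" for n
    using prod_mono[of "{..<n}" "\<lambda>k. displacement 1 (neg U k)" "\<lambda>k. ?d"]
      displacement_neg_antimono[OF U] by simp
  have eq: "index U (neg U n) = ?d ^ n" for n
    using displacement_le_index_neg(1)[OF U, of n] le[of n] multiplicativeD[OF m, of n]
    by (simp add: index_neg_eq_prod[OF U])
  have "U \<inter> pre n U = neg U n" for n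
    using displacement_le_index_neg(2)[OF U, of n] eq[of n] multiplicativeD[OF m, of n] by simp
  moreover have "displacement 1 (neg U k) = ?d" for k
  proof -
    have "?d ^ k * displacement 1 (neg U k) = ?d ^ k * ?d"
      using eq[of k] eq[of "Suc k"] unfolding index_neg_eq_prod[OF U] by (simp add: mult.commute)
    then show ?thesis
      using displacement_pos[OF U, of 1] by simp
  qed
  ultimately show "?int \<and> ?const" by blast
next
  assume h: "?int \<and> ?const"
  show "multiplicative U"
    unfolding multiplicative_def
  proof
    fix n
    have "displacement n U = index U (neg U n)"
      using h displacement_eq_index[OF U, of n] by simp
    also have "\<dots> = displacement 1 U ^ n"
      using h unfolding index_neg_eq_prod[OF U] by simp
    finally show "displacement n U = displacement 1 U ^ n" .
  qed
qed

text \<open>Think of \<open>M\<close> as a set of points with a past in \<open>W\<close> and of \<open>B\<close> as a set of points with a future in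
  \<open>W\<close>. For \<open>x = m b\<close> in \<open>W\<^sub>-\<^sub>k\<close>, a preimage of \<open>m\<close> in \<open>M\<close> shows
  \<open>x \<in> \<alpha>(W\<^sub>-\<^sub>k\<^sub>-\<^sub>1) W\<^sub>-\<^sub>k\<^sub>-\<^sub>1\<close>, so the indices are constant. If \<open>x = m b\<close> returns to \<open>W\<close> at time \<open>n\<close>, write
  \<open>\<alpha>\<^sup>n(m) = \<alpha>\<^sup>n(y) b'\<close> with \<open>y, \<alpha>(y), \<dots>, \<alpha>\<^sup>n(y)\<close> in \<open>M\<close>; by the last hypothesis \<open>y\<^sup>-\<^sup>1 m\<close> is in \<open>B\<close>, so all
  three factors of \<open>x = y (y\<^sup>-\<^sup>1 m) b\<close> stay in \<open>W\<close> up to time \<open>n\<close>.\<close>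
lemma multiplicative_if_factorization:
  assumes W: "compact_open W" and M: "subgroup M G" "M \<subseteq> W" "M \<subseteq> \<alpha> ` M"
    and B: "B \<subseteq> W" "\<And>b. b \<in> B \<Longrightarrow> \<alpha> b \<in> B"
    and fac: "W \<subseteq> M <#> B"
    and descend: "\<And>t n. t \<in> M \<Longrightarrow> (\<alpha> ^^ n) t \<in> B \<Longrightarrow> t \<in> B"
  shows "multiplicative W"
proof -
  note S = compact_openD[OF W]
  have powB: "(\<alpha> ^^ n) b \<in> B" if "b \<in> B" for b n
    using that B(2) by (induction n) auto
  have Bc: "b \<in> carrier G" if "b \<in> B" for b
    using that B(1) S(4) by blast
  have Mc: "m \<in> carrier G" if "m \<in> M" for m
    using that M(2) S(4) by blast
  have B_neg: "b \<in> neg W k" if "b \<in> B" for b k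
    using powB[OF that] Bc[OF that] B(1) unfolding mem_neg by blast
  have split: "\<exists>m\<in>M. \<exists>b\<in>B. x = m \<otimes> b" if "x \<in> W" for x
    using that fac unfolding set_mult_def by blast
  have "displacement 1 (neg W (Suc k)) = displacement 1 (neg W k)" for k
    unfolding displacement_neg_eq_iff[OF W]
  proof
    note N = compact_openD(1)[OF compact_open_neg[OF W]]
    fix x assume x: "x \<in> neg W k"
    then have "x \<in> W" using neg_subset by blast
    then obtain m b where mb: "m \<in> M" "b \<in> B" "x = m \<otimes> b" using split by blast
    have mbc: "m \<in> carrier G" "b \<in> carrier G" using mb Mc Bc by auto
    have "x \<otimes> inv b \<in> neg W k"
      using subgroup.m_closed[OF N x subgroup.m_inv_closed[OF N B_neg[OF mb(2)]]] .
    then have m: "m \<in> neg W k"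
      using mb mbc by (simp add: m_assoc)
    obtain y where y: "y \<in> M" "m = \<alpha> y" using mb(1) M(3) by blast
    have "(\<alpha> ^^ j) y \<in> W" if "j \<le> Suc k" for j
    proof (cases j)
      case 0
      then show ?thesis using y M(2) by auto
    next
      case (Suc i)
      then have "(\<alpha> ^^ i) m \<in> W"
        using m that unfolding mem_neg by auto
      then show ?thesis
        unfolding Suc y(2) pow_map .
    qed
    then have "y \<in> neg W (Suc k)"
      using Mc[OF y(1)] unfolding mem_neg by blast
    moreover have "inv (\<alpha> y) \<otimes> x = b"
      using mb y mbc by (simp add: mult_inv_cancel_left)
    ultimately show "\<exists>y\<in>neg W (Suc k). inv (\<alpha> y) \<otimes> x \<in> neg W (Suc k)"
      using B_neg[OF mb(2)] by metis
  qed
  then have const: "displacement 1 (neg W k) = displacement 1 W" for k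
    using neg_0[OF S(4)] by (induction k) simp_all
  have "neg W n \<subseteq> W \<inter> pre n W" for n
    by (auto simp: mem_pre mem_neg dest: subsetD[OF neg_subset])
  moreover have "x \<in> neg W n" if x: "x \<in> W \<inter> pre n W" for x n
  proof -
    obtain m b where mb: "m \<in> M" "b \<in> B" "x = m \<otimes> b" using split x by blast
    note N = compact_openD(1)[OF compact_open_neg[OF W, of n]]
    have mbc: "m \<in> carrier G" "b \<in> carrier G" using mb Mc Bc by auto
    have "(\<alpha> ^^ n) x \<otimes> inv (\<alpha> ^^ n) b \<in> W"
      using x powB[OF mb(2)] B(1) subgroup.m_closed[OF S(1)] subgroup.m_inv_closed[OF S(1)]
      unfolding mem_pre Int_iff by blast
    then have "(\<alpha> ^^ n) m \<in> W"
      using mb mbc by (simp add: m_assoc)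
    then obtain m' b' where mb': "m' \<in> M" "b' \<in> B" "(\<alpha> ^^ n) m = m' \<otimes> b'" using split by blast
    obtain y where y: "y \<in> M" "(\<alpha> ^^ n) y = m'" "\<forall>j\<le>n. (\<alpha> ^^ j) y \<in> M"
      using backward_orbit[OF M(3) mb'(1)] by blast
    have yc: "y \<in> carrier G" "b' \<in> carrier G" using y mb' Mc Bc by auto
    have "(\<alpha> ^^ n) (inv y \<otimes> m) = b'"
      using y(2) mb' mbc yc by (simp add: mult_inv_cancel_left Mc)
    then have "inv y \<otimes> m \<in> B"
      using descend[of "inv y \<otimes> m" n] mb mb' y subgroup.m_closed[OF M(1)]
        subgroup.m_inv_closed[OF M(1)] by simp
    then have 1: "inv y \<otimes> m \<in> neg W n" by (rule B_neg)
    have 2: "y \<in> neg W n"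
      using y(3) yc M(2) unfolding mem_neg by blast
    have "y \<otimes> (inv y \<otimes> m) \<otimes> b \<in> neg W n"
      using subgroup.m_closed[OF N subgroup.m_closed[OF N 2 1] B_neg[OF mb(2)]] .
    then show ?thesis
      using mb mbc yc by (simp add: mult_inv_cancel_left)
  qed
  ultimately have "W \<inter> pre n W = neg W n" for n
    by blast
  with const show ?thesis
    unfolding multiplicative_iff[OF W] by blast
qed

section \<open>Multiplicativity and tidiness\<close>

text \<open>Iterating \<open>U\<^sub>-\<^sub>k = \<alpha>(U\<^sub>-\<^sub>k\<^sub>-\<^sub>1) U\<^sub>-\<^sub>k\<^sub>-\<^sub>1\<close> yields first \<open>U\<^sub>-\<^sub>k = \<alpha>\<^sup>n(U\<^sub>-\<^sub>n\<^sub>-\<^sub>k) U\<^sub>-\<^sub>k\<^sub>-\<^sub>1\<close> for all \<open>n\<close>, then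
  \<open>U = U\<^sub>n U\<^sub>-\<^sub>k\<close> for all \<open>n\<close> and \<open>k\<close>, and compactness allows passing to the limit.\<close>
lemma tidy_above_if_displacement_constant:
  assumes U: "compact_open U" and const: "\<And>k. displacement 1 (neg U (Suc k)) = displacement 1 (neg U k)"
  shows "tidy_above G \<alpha> U"
proof -
  note S = compact_openD[OF U] and N = compact_openD[OF compact_open_neg[OF U]]
  have step: "\<exists>y\<in>neg U (Suc k). inv (\<alpha> y) \<otimes> x \<in> neg U (Suc k)" if "x \<in> neg U k" for x k
    using const that displacement_neg_eq_iff[OF U] by blast
  \<comment> \<open>The factor \<open>inv (\<alpha> z) \<otimes> y\<close> is absorbed: \<open>\<alpha>\<^sup>n\<close> maps \<open>U\<^sub>-\<^sub>n\<^sub>-\<^sub>k\<^sub>-\<^sub>1\<close> into \<open>U\<^sub>-\<^sub>k\<^sub>-\<^sub>1\<close>.\<close>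
  have many: "\<exists>y\<in>neg U (n + k). inv ((\<alpha> ^^ n) y) \<otimes> x \<in> neg U (Suc k)"
    if x: "x \<in> neg U k" for x n k
  proof (induction n)
    case 0
    have "inv x \<otimes> x = \<one>" using x N(4) by (meson l_inv subsetD)
    then show ?case
      using x subgroup.one_closed[OF N(1)] by (intro bexI[of _ x]) auto
  next
    case (Suc n)
    then obtain y where y: "y \<in> neg U (n + k)" "inv ((\<alpha> ^^ n) y) \<otimes> x \<in> neg U (Suc k)" by blast
    from step[OF y(1)] obtain z where z: "z \<in> neg U (Suc (n + k))"
      "inv (\<alpha> z) \<otimes> y \<in> neg U (Suc (n + k))" by blast
    have c: "x \<in> carrier G" "y \<in> carrier G" "z \<in> carrier G"
      using x y z N(4) by blast+
    have "(\<alpha> ^^ n) (inv (\<alpha> z) \<otimes> y) \<in> neg U (Suc k)"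
    proof -
      have "(\<alpha> ^^ j) ((\<alpha> ^^ n) (inv (\<alpha> z) \<otimes> y)) \<in> U" if "j \<le> Suc k" for j
      proof -
        have "j + n \<le> Suc (n + k)" using that by simp
        then show ?thesis
          using z(2) unfolding pow_pow mem_neg by blast
      qed
      then show ?thesis
        unfolding mem_neg using c by simp
    qed
    from subgroup.m_closed[OF N(1) this y(2)]
    have "inv ((\<alpha> ^^ n) (\<alpha> z)) \<otimes> x \<in> neg U (Suc k)"
      using c by (simp add: m_assoc mult_inv_cancel_left)
    then show ?case
      using z(1) unfolding pow_map by (intro bexI[of _ z]) simp_all
  qed
  have all: "\<exists>y\<in>neg U n. inv ((\<alpha> ^^ n) y) \<otimes> x \<in> neg U k" if x: "x \<in> U" for x n k
  proof (induction k)
    case 0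
    have "inv ((\<alpha> ^^ n) \<one>) \<otimes> x \<in> neg U 0"
      using x S(4) neg_0[OF S(4)] by auto
    then show ?case
      using subgroup.one_closed[OF N(1)] by blast
  next
    case (Suc k)
    then obtain y where y: "y \<in> neg U n" "inv ((\<alpha> ^^ n) y) \<otimes> x \<in> neg U k" by blast
    from many[OF y(2), of n] obtain z where z: "z \<in> neg U (n + k)"
      "inv ((\<alpha> ^^ n) z) \<otimes> (inv ((\<alpha> ^^ n) y) \<otimes> x) \<in> neg U (Suc k)" by blast
    have c: "x \<in> carrier G" "y \<in> carrier G" "z \<in> carrier G"
      using x y z S(4) N(4) by blast+
    have "z \<in> neg U n"
      using z(1) neg_antimono[of n "n + k"] by auto
    then have "y \<otimes> z \<in> neg U n"
      using subgroup.m_closed[OF N(1) y(1)] by blast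
    moreover have "inv ((\<alpha> ^^ n) (y \<otimes> z)) \<otimes> x \<in> neg U (Suc k)"
      using z(2) c by (simp add: inv_mult_group m_assoc)
    ultimately show ?case by blast
  qed
  have "x \<in> plus_part U <#> minus_part U" if x: "x \<in> U" for x
  proof -
    have xc: "x \<in> carrier G" using x S(4) by blast
    \<comment> \<open>The possible left factors of \<open>x\<close> in \<open>U\<^sub>n U\<^sub>-\<^sub>n\<close> form a decreasing sequence of compact sets.\<close>
    define C where "C n = pos U n \<inter> {u \<in> topspace T. inv u \<otimes> x \<in> neg U n}" for n
    have "continuous_map T T (\<lambda>u. inv u \<otimes> x)"
      using continuous_map_mult[OF continuous_inv continuous_map_const_carrier[OF xc]] .
    then have "closedin T {u \<in> topspace T. inv u \<otimes> x \<in> neg U n}" for n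
      using closedin_open_subgroup[OF N(1,3)] by (rule closedin_continuous_map_preimage)
    then have "compactin T (C n)" for n
      unfolding C_def using compactin_pos[OF U] by (intro compact_Int_closedin)
    moreover have "C n \<noteq> {}" for n
    proof -
      obtain y where y: "y \<in> neg U n" "inv ((\<alpha> ^^ n) y) \<otimes> x \<in> neg U n"
        using all[OF x, of n n] by blast
      then have "(\<alpha> ^^ n) y \<in> C n"
        unfolding C_def pos_eq_image_neg[OF S(4)] topspace_eq using N(4)[of n] by auto
      then show ?thesis by blast
    qed
    moreover have "C (Suc n) \<subseteq> C n" for n
      unfolding C_def using pos_Suc_subset[of U n] neg_antimono[of n "Suc n" U] by auto
    ultimately have "(\<Inter>n. C n) \<noteq> {}"
      by (rule compactin_nest_nonempty[OF Hausdorff])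
    then obtain u where u: "\<And>n. u \<in> C n" by blast
    have uc: "u \<in> carrier G"
      using u[of 0] unfolding C_def topspace_eq by blast
    have "u \<in> plus_part U"
      unfolding mem_plus_part using u unfolding C_def by blast
    moreover have "inv u \<otimes> x \<in> minus_part U"
      using u unfolding C_def U_minus_def by blast
    moreover have "x = u \<otimes> (inv u \<otimes> x)"
      using uc xc by (simp add: mult_inv_cancel_left)
    ultimately show ?thesis
      unfolding set_mult_def by blast
  qed
  moreover have "plus_part U <#> minus_part U \<subseteq> U"
    using plus_part_subset minus_part_subset subgroup.m_closed[OF S(1)] unfolding set_mult_def by blast
  ultimately show ?thesis
    unfolding tidy_above_def by blast
qed

text \<open>An orbit starting in \<open>U\<close> and ending up in \<open>U\<^sub>-\<close> is in \<open>U\<close> at time \<open>0\<close> and again at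
  some time \<open>n\<close>, hence at all times in between. So \<open>U \<inter> U\<^sub>-\<^sub>- = U\<^sub>-\<close>, which is closed, and
  a subgroup whose intersection with an open subgroup is closed is itself closed.\<close>
lemma multiplicative_imp_tidy:
  assumes U: "compact_open U" and m: "multiplicative U"
  shows "tidy G T \<alpha> U"
proof -
  note S = compact_openD[OF U]
  have h: "U \<inter> pre n U = neg U n" "displacement 1 (neg U n) = displacement 1 U" for n
    using m multiplicative_iff[OF U] by blast+
  have "U \<inter> minus_hull U \<subseteq> minus_part U"
  proof
    fix x assume x: "x \<in> U \<inter> minus_hull U"
    then obtain n where n: "(\<alpha> ^^ n) x \<in> minus_part U" "x \<in> carrier G"
      unfolding Int_iff mem_minus_hull by blast
    have "x \<in> neg U n"
      using x n minus_part_subset unfolding h(1)[symmetric] Int_iff mem_pre by blast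
    have "(\<alpha> ^^ k) x \<in> U" for k
    proof (cases "k \<le> n")
      case True
      with \<open>x \<in> neg U n\<close> show ?thesis unfolding mem_neg by blast
    next
      case False
      then have "k = (k - n) + n" by simp
      moreover have "(\<alpha> ^^ (k - n)) ((\<alpha> ^^ n) x) \<in> U"
        using n(1) unfolding mem_minus_part by blast
      ultimately show ?thesis
        unfolding pow_pow by metis
    qed
    with n show "x \<in> minus_part U"
      unfolding mem_minus_part by blast
  qed
  moreover have "minus_part U \<subseteq> U \<inter> minus_hull U"
    using minus_part_subset pow_mem_minus_part unfolding mem_minus_hull by (auto simp: mem_minus_hull mem_minus_part)
  ultimately have "U \<inter> minus_hull U = minus_part U" by blast
  moreover have "closedin T (minus_part U)"
    unfolding U_minus_def
    using closedin_open_subgroup compact_openD[OF compact_open_neg[OF U]] by (intro closedin_INT) auto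
  ultimately have "closedin T (minus_hull U)"
    using closedin_subgroup_if_closedin_Int[OF subgroup_minus_hull[OF S(1)] S(1,3)] by simp
  moreover have "tidy_above G \<alpha> U"
    using tidy_above_if_displacement_constant[OF U] h(2) by simp
  ultimately show ?thesis
    by (simp add: tidy_def tidy_below_def)
qed

text \<open>The compact group \<open>K = U \<inter> U\<^sub>-\<^sub>-\<close> is the increasing union of its closed subgroups
  \<open>P n = U \<inter> \<alpha>\<^sup>-\<^sup>n(U\<^sub>-)\<close>. By Baire's theorem one of them has interior points, so it and all later ones
  are open in \<open>K\<close>, and by compactness one of them is all of \<open>K\<close>.\<close>
lemma minus_hull_Int_bounded:
  assumes U: "compact_open U" and cl: "closedin T (minus_hull U)"
  shows "\<exists>N. U \<inter> minus_hull U \<subseteq> pre N (minus_part U)"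
proof -
  note S = compact_openD[OF U]
  define K where "K = U \<inter> minus_hull U"
  define P where "P n = U \<inter> pre n (minus_part U)" for n
  note mK = subgroup_minus_part[OF S(1)]
  have K: "subgroup K G"
    unfolding K_def using subgroups_Inter_pair[OF S(1) subgroup_minus_hull[OF S(1)]] .
  have P: "subgroup (P n) G" for n
    unfolding P_def using subgroups_Inter_pair[OF S(1) subgroup_pre[OF mK]] .
  have KP: "K = (\<Union>n. P n)"
    unfolding K_def P_def U_minus_minus_def by blast
  have compK: "compactin T K"
    unfolding K_def using compact_Int_closedin[OF S(2) cl] .
  have mono: "P m \<subseteq> P n" if "m \<le> n" for m n
  proof
    fix x assume x: "x \<in> P m"
    then have "(\<alpha> ^^ (n - m)) ((\<alpha> ^^ m) x) \<in> minus_part U"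
      unfolding P_def Int_iff mem_pre using pow_mem_minus_part by blast
    then show "x \<in> P n"
      using x that unfolding P_def Int_iff mem_pre pow_pow by simp
  qed
  have "closedin T (minus_part U)"
    unfolding U_minus_def
    using closedin_open_subgroup compact_openD[OF compact_open_neg[OF U]] by (intro closedin_INT) auto
  then have clP: "closedin T (P n)" for n
    unfolding P_def using closedin_pre closedin_open_subgroup[OF S(1,3)] by (intro closedin_Int)
  let ?X = "subtopology T K"
  have topX: "topspace ?X = K"
    using subgroup.subset[OF K] topspace_eq by auto
  have compX: "compact_space ?X"
    using compK compactin_subspace by blast
  have HX: "Hausdorff_space ?X"
    using Hausdorff_space_subtopology[OF Hausdorff] .
  have "\<exists>n. ?X interior_of P n \<noteq> {}"
  proof (rule ccontr)
    assume no: "\<nexists>n. ?X interior_of P n \<noteq> {}"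
    have "?X interior_of \<Union>(range P) = {}"
    proof (rule Baire_category_alt)
      show "completely_metrizable_space ?X \<or> locally_compact_space ?X \<and> regular_space ?X"
        using compX HX compact_imp_locally_compact_space compact_Hausdorff_imp_regular_space by blast
      show "countable (range P)" by simp
      show "closedin ?X S \<and> ?X interior_of S = {}" if "S \<in> range P" for S
        using that clP no KP by (auto intro: closedin_subset_topspace)
    qed
    moreover have "?X interior_of \<Union>(range P) = K"
      using interior_of_topspace[of ?X] unfolding topX KP[symmetric] .
    ultimately show False
      using subgroup.one_closed[OF K] by blast
  qed
  then obtain n x where "x \<in> ?X interior_of P n" by blast
  then obtain Q where Q: "openin ?X Q" "x \<in> Q" "Q \<subseteq> P n"
    unfolding interior_of_def by blast
  then obtain O' where O': "openin T O'" "Q = O' \<inter> K"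
    unfolding openin_subtopology by blast
  have xP: "x \<in> P n" "x \<in> O'" using Q O' by auto
  have Pc: "p \<in> carrier G" if "p \<in> P k" for p k
    using that subgroup.mem_carrier[OF P] by blast
  \<comment> \<open>Translating an interior point \<open>x\<close> of \<open>P n\<close> to \<open>y\<close> inside a larger \<open>P m\<close>.\<close>
  have nb: "\<exists>V m. openin T V \<and> y \<in> V \<and> V \<inter> K \<subseteq> P m" if y: "y \<in> K" for y
  proof -
    obtain m0 where "y \<in> P m0" using y KP by blast
    define m where "m = max m0 n"
    have ym: "y \<in> P m" "P n \<subseteq> P m"
      using \<open>y \<in> P m0\<close> mono[of m0 m] mono[of n m] by (auto simp: m_def)
    have xm: "x \<in> P m" using xP ym by blast
    define a where "a = y \<otimes> inv x"
    have aP: "a \<in> P m"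
      unfolding a_def using subgroup.m_closed[OF P ym(1) subgroup.m_inv_closed[OF P xm]] .
    have ac: "a \<in> carrier G" using Pc[OF aP] .
    have "openin T (a <# O')"
      using openin_lcoset[OF O'(1) ac] .
    moreover have "y \<in> a <# O'"
    proof -
      have "y = a \<otimes> x"
        using Pc[OF ym(1)] Pc[OF xm] by (simp add: a_def m_assoc)
      then show ?thesis
        using xP unfolding l_coset_def by blast
    qed
    moreover have "(a <# O') \<inter> K \<subseteq> P m"
    proof
      fix z assume z: "z \<in> (a <# O') \<inter> K"
      then obtain w where w: "w \<in> O'" "z = a \<otimes> w"
        unfolding l_coset_def by blast
      have wc: "w \<in> carrier G"
        using w openin_subset_carrier[OF O'(1)] by blast
      have "w = inv a \<otimes> z"
        using w wc ac by (simp add: mult_inv_cancel_left)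
      moreover have "a \<in> K" using aP KP by blast
      ultimately have "w \<in> K"
        using z subgroup.m_closed[OF K] subgroup.m_inv_closed[OF K] by blast
      then have "w \<in> P m"
        using w(1) O'(2) Q(3) ym(2) by blast
      then show "z \<in> P m"
        using w(2) subgroup.m_closed[OF P aP] by blast
    qed
    ultimately show ?thesis by blast
  qed
  define \<U> where "\<U> = {V. openin T V \<and> (\<exists>m. V \<inter> K \<subseteq> P m)}"
  have "\<And>V. V \<in> \<U> \<Longrightarrow> openin T V" "K \<subseteq> \<Union>\<U>"
    using nb unfolding \<U>_def by blast+
  then obtain \<F> where F: "finite \<F>" "\<F> \<subseteq> \<U>" "K \<subseteq> \<Union>\<F>"
    using compactinD[OF compK] by metis
  then have "\<forall>V\<in>\<F>. \<exists>m. V \<inter> K \<subseteq> P m"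
    unfolding \<U>_def by blast
  then obtain f where f: "\<And>V. V \<in> \<F> \<Longrightarrow> V \<inter> K \<subseteq> P (f V)"
    by metis
  obtain N where N: "\<And>V. V \<in> \<F> \<Longrightarrow> f V \<le> N"
    using F(1) finite_nat_set_iff_bounded_le[of "f ` \<F>"] by blast
  have "K \<subseteq> P N"
    using F(3) f mono[OF N] by blast
  then show ?thesis
    unfolding K_def P_def by blast
qed

text \<open>For \<open>t \<in> U\<^sub>+ \<inter> U\<^sub>-\<^sub>-\<close> choose \<open>y \<in> U\<^sub>+\<close> with \<open>\<alpha>\<^sup>N(y) = t\<close>, where \<open>N\<close> bounds the entry times into \<open>U\<^sub>-\<close>.
  Since \<open>y\<close> also lies in \<open>U \<inter> U\<^sub>-\<^sub>-\<close>, its image \<open>t\<close> is in \<open>U\<^sub>-\<close>.\<close>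
lemma tidy_imp_multiplicative:
  assumes U: "compact_open U" and tidy: "tidy G T \<alpha> U"
  shows "multiplicative U"
proof (rule multiplicative_if_factorization[OF U subgroup_plus_part[OF U] plus_part_subset
      plus_part_subset_image[OF U] minus_part_subset])
  note S = compact_openD[OF U]
  show "\<alpha> b \<in> minus_part U" if "b \<in> minus_part U" for b
    using pow_mem_minus_part[OF that, of 1] by simp
  show "U \<subseteq> plus_part U <#> minus_part U"
    using tidy by (simp add: tidy_def tidy_above_def)
  fix t n assume t: "t \<in> plus_part U" "(\<alpha> ^^ n) t \<in> minus_part U"
  obtain N where N: "U \<inter> minus_hull U \<subseteq> pre N (minus_part U)"
    using minus_hull_Int_bounded[OF U] tidy by (auto simp: tidy_def tidy_below_def)
  obtain y where y: "y \<in> plus_part U" "(\<alpha> ^^ N) y = t"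
    using backward_orbit[OF plus_part_subset_image[OF U] t(1)] by blast
  have yU: "y \<in> U" using y plus_part_subset by blast
  moreover have "(\<alpha> ^^ (n + N)) y \<in> minus_part U"
    using t(2) y(2) pow_pow by metis
  ultimately have "y \<in> U \<inter> minus_hull U"
    using S(4) unfolding Int_iff mem_minus_hull by blast
  with N show "t \<in> minus_part U"
    using y(2) unfolding mem_pre subset_iff by blast
qed

section \<open>Existence of multiplicative subgroups\<close>

text \<open>The increasing union of the groups \<open>\<alpha>\<^sup>m(U\<^sub>+)\<close> is usually written \<open>U\<^sub>+\<^sub>+\<close>; it is the counterpart of
  \<open>U\<^sub>-\<^sub>-\<close> for the past.\<close>
definition plus_hull :: "'a set \<Rightarrow> 'a set" where
  "plus_hull U = (\<Union>m. (\<alpha> ^^ m) ` plus_part U)"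

text \<open>Points with a backward orbit eventually in \<open>U\<^sub>+\<close> and a forward orbit eventually in \<open>U\<^sub>-\<close>. The group is
  called \<open>L\<close> below.\<close>
definition homoclinic :: "'a set \<Rightarrow> 'a set" where
  "homoclinic U = plus_hull U \<inter> minus_hull U"

lemma plus_powers_mono:
  assumes U: "compact_open U" and "m \<le> n"
  shows "(\<alpha> ^^ m) ` plus_part U \<subseteq> (\<alpha> ^^ n) ` plus_part U"
proof
  fix x assume "x \<in> (\<alpha> ^^ m) ` plus_part U"
  then obtain u where u: "u \<in> plus_part U" "x = (\<alpha> ^^ m) u" by blast
  obtain y where y: "y \<in> plus_part U" "(\<alpha> ^^ (n - m)) y = u"
    using backward_orbit[OF plus_part_subset_image[OF U] u(1)] by blast
  have "(\<alpha> ^^ (m + (n - m))) y = x"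
    using y(2) u(2) pow_pow by metis
  then have "(\<alpha> ^^ n) y = x" using assms(2) by simp
  with y(1) show "x \<in> (\<alpha> ^^ n) ` plus_part U" by blast
qed

lemma subgroup_plus_hull:
  assumes U: "compact_open U"
  shows "subgroup (plus_hull U) G"
proof (rule subgroupI)
  have sub: "subgroup ((\<alpha> ^^ m) ` plus_part U) G" for m
    using subgroup_image_pow[OF subgroup_plus_part[OF U]] .
  show "plus_hull U \<subseteq> carrier G"
    using subgroup.subset[OF sub] by (auto simp: plus_hull_def)
  show "plus_hull U \<noteq> {}"
    using subgroup.one_closed[OF sub[of 0]] unfolding plus_hull_def by blast
  show "inv a \<in> plus_hull U" if "a \<in> plus_hull U" for a
    using that subgroup.m_inv_closed[OF sub] unfolding plus_hull_def by blast
  show "a \<otimes> b \<in> plus_hull U" if ab: "a \<in> plus_hull U" "b \<in> plus_hull U" for a b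
  proof -
    obtain m n where mn: "a \<in> (\<alpha> ^^ m) ` plus_part U" "b \<in> (\<alpha> ^^ n) ` plus_part U"
      using ab unfolding plus_hull_def by blast
    have "a \<in> (\<alpha> ^^ (max m n)) ` plus_part U" "b \<in> (\<alpha> ^^ (max m n)) ` plus_part U"
      using mn plus_powers_mono[OF U, of m "max m n"] plus_powers_mono[OF U, of n "max m n"] by auto
    then have "a \<otimes> b \<in> (\<alpha> ^^ (max m n)) ` plus_part U"
      using subgroup.m_closed[OF sub] by blast
    then show ?thesis
      unfolding plus_hull_def by blast
  qed
qed

lemma subgroup_homoclinic: "compact_open U \<Longrightarrow> subgroup (homoclinic U) G"
  unfolding homoclinic_def
  using subgroups_Inter_pair subgroup_plus_hull subgroup_minus_hull compact_openD(1) by blast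

lemma pow_mem_minus_hull_iff:
  assumes "x \<in> carrier G"
  shows "(\<alpha> ^^ k) x \<in> minus_hull U \<longleftrightarrow> x \<in> minus_hull U"
proof
  assume "(\<alpha> ^^ k) x \<in> minus_hull U"
  then show "x \<in> minus_hull U"
    using assms unfolding mem_minus_hull pow_pow by blast
next
  assume "x \<in> minus_hull U"
  then obtain n where "(\<alpha> ^^ n) x \<in> minus_part U" unfolding mem_minus_hull by blast
  from pow_mem_minus_part[OF this, of k] have "(\<alpha> ^^ n) ((\<alpha> ^^ k) x) \<in> minus_part U"
    unfolding pow_pow by (simp add: add.commute)
  then show "(\<alpha> ^^ k) x \<in> minus_hull U"
    using assms unfolding mem_minus_hull by auto
qed

lemma pow_mem_plus_hull: "x \<in> plus_hull U \<Longrightarrow> (\<alpha> ^^ k) x \<in> plus_hull U"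
  unfolding plus_hull_def by (auto simp: pow_pow) blast

lemma pow_mem_homoclinic:
  assumes "compact_open U" "x \<in> homoclinic U"
  shows "(\<alpha> ^^ k) x \<in> homoclinic U"
  using assms pow_mem_plus_hull pow_mem_minus_hull_iff subgroup.mem_carrier[OF subgroup_homoclinic]
  unfolding homoclinic_def by blast

lemma homoclinic_subset_image:
  assumes U: "compact_open U"
  shows "homoclinic U \<subseteq> \<alpha> ` homoclinic U"
proof
  fix x assume x: "x \<in> homoclinic U"
  then obtain m where "x \<in> (\<alpha> ^^ m) ` plus_part U" "x \<in> minus_hull U"
    unfolding homoclinic_def plus_hull_def by blast
  then obtain u where u: "u \<in> (\<alpha> ^^ m) ` plus_part U" "x = \<alpha> u"
    using plus_powers_mono[OF U, of m "Suc m"] by (force simp: pow_map[symmetric])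
  have "u \<in> plus_hull U" using u(1) unfolding plus_hull_def by blast
  moreover from this have "u \<in> minus_hull U"
    using subgroup.mem_carrier[OF subgroup_plus_hull[OF U]] pow_mem_minus_hull_iff[of u 1 U] x u
    unfolding homoclinic_def by simp
  ultimately show "x \<in> \<alpha> ` homoclinic U"
    using u(2) unfolding homoclinic_def by blast
qed

text \<open>The group \<open>A = L \<inter> \<alpha>(U\<^sub>+)\<close> meets only finitely many cosets of \<open>U\<close>; let \<open>p\<close> be a time after which the
  finitely many representatives have entered \<open>U\<^sub>-\<close>. A point of \<open>L \<inter> \<alpha>\<^sup>m\<^sup>+\<^sup>1(U\<^sub>+)\<close> is
  \<open>\<alpha>\<^sup>m(r) \<alpha>\<^sup>m(l)\<close> with a representative \<open>r\<close> and with \<open>l \<in> L \<inter> U\<^sub>+\<close>. For \<open>m \<ge> p\<close> the first factor is in \<open>U\<^sub>-\<close>,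
  so by induction on \<open>m\<close> all of \<open>L\<close> lies in \<open>U\<^sub>- \<alpha>\<^sup>p(U\<^sub>+)\<close>. The bound with \<open>\<alpha>\<^sup>p(U)\<close> in place of
  \<open>\<alpha>\<^sup>p(U\<^sub>+)\<close> is enough for counting cosets.\<close>
lemma homoclinic_subset_compact_product:
  assumes U: "compact_open U"
  shows "\<exists>p. homoclinic U \<subseteq> minus_part U <#> (\<alpha> ^^ p) ` U"
proof -
  note S = compact_openD[OF U]
  note mU = subgroup_minus_part[OF S(1)]
  note LU = subgroup_homoclinic[OF U]
  define A where "A = homoclinic U \<inter> \<alpha> ` plus_part U"
  have Ac: "A \<subseteq> carrier G" using subgroup.subset[OF LU] unfolding A_def by blast
  have "finite (translates (\<alpha> ` U) U)"
    using finite_translates_image_pow[OF U U, of 1] by simp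
  moreover have "translates A U \<subseteq> translates (\<alpha> ` U) U"
    unfolding translates_def A_def using plus_part_subset by blast
  ultimately have "finite (translates A U)"
    using finite_subset by blast
  then obtain F where F: "F \<subseteq> A" "finite F" "translates A U = (\<lambda>a. a <# U) ` F"
    using translates_transversal by metis
  have "\<exists>n. (\<alpha> ^^ n) r \<in> minus_part U" if "r \<in> F" for r
    using that F(1) unfolding A_def homoclinic_def Int_iff subset_iff mem_minus_hull by blast
  then obtain f where f: "\<And>r. r \<in> F \<Longrightarrow> (\<alpha> ^^ (f r)) r \<in> minus_part U" by metis
  obtain p where p: "\<And>r. r \<in> F \<Longrightarrow> f r \<le> p"
    using F(2) finite_nat_set_iff_bounded_le[of "f ` F"] by blast
  have late: "(\<alpha> ^^ m) r \<in> minus_part U" if "r \<in> F" "p \<le> m" for r m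
  proof -
    have "m = (m - f r) + f r" using p[OF that(1)] that(2) by simp
    then show ?thesis
      using pow_mem_minus_part[OF f[OF that(1)], of "m - f r"] pow_pow by metis
  qed
  let ?K = "minus_part U <#> (\<alpha> ^^ p) ` U"
  have base: "(\<alpha> ^^ m) ` plus_part U \<subseteq> ?K" if "m \<le> p" for m
  proof
    fix x assume "x \<in> (\<alpha> ^^ m) ` plus_part U"
    then have x: "x \<in> (\<alpha> ^^ p) ` U"
      using plus_powers_mono[OF U that] plus_part_subset by blast
    then have "x = \<one> \<otimes> x"
      using S(4) by auto
    then show "x \<in> ?K"
      using x subgroup.one_closed[OF mU] unfolding set_mult_def by blast
  qed
  have "homoclinic U \<inter> (\<alpha> ^^ m) ` plus_part U \<subseteq> ?K" for m
  proof (induction m)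
    case 0
    then show ?case using base[of 0] by blast
  next
    case (Suc m)
    show ?case
    proof (cases "Suc m \<le> p")
      case True
      then show ?thesis using base by blast
    next
      case False
      show ?thesis
      proof
        fix x assume x: "x \<in> homoclinic U \<inter> (\<alpha> ^^ Suc m) ` plus_part U"
        then obtain u where u: "u \<in> plus_part U" "x = (\<alpha> ^^ m) (\<alpha> u)"
          unfolding pow_map by blast
        have uc: "u \<in> carrier G" using u(1) plus_part_subset S(4) by blast
        have "\<alpha> u \<in> minus_hull U"
          using x u(2) pow_mem_minus_hull_iff[of "\<alpha> u" m U] uc unfolding homoclinic_def by simp
        moreover have "\<alpha> u \<in> plus_hull U"
        proof -
          have "\<alpha> u \<in> (\<alpha> ^^ 1) ` plus_part U" using u(1) by simp
          then show ?thesis unfolding plus_hull_def by blast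
        qed
        ultimately have aL: "\<alpha> u \<in> homoclinic U" unfolding homoclinic_def by blast
        then have aA: "\<alpha> u \<in> A" using u(1) unfolding A_def by blast
        then have "\<alpha> u <# U \<in> (\<lambda>a. a <# U) ` F"
          using F(3) unfolding translates_def by blast
        then obtain r where r: "r \<in> F" "r <# U = \<alpha> u <# U" by auto
        have rA: "r \<in> A" using r F(1) by blast
        then have rc: "r \<in> carrier G" using Ac by blast
        define l where "l = inv r \<otimes> \<alpha> u"
        have lU: "l \<in> U"
          unfolding l_def using r(2) lcoset_eq_iff[OF S(1) rc] uc by simp
        have lL: "l \<in> homoclinic U"
          unfolding l_def using rA aL subgroup.m_closed[OF LU] subgroup.m_inv_closed[OF LU]
          unfolding A_def by blast
        have lc: "l \<in> carrier G" using lU S(4) by blast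
        obtain v where v: "v \<in> plus_part U" "r = \<alpha> v" using rA unfolding A_def by blast
        have vc: "v \<in> carrier G" using v(1) plus_part_subset S(4) by blast
        have "l = \<alpha> (inv v \<otimes> u)"
          unfolding l_def v(2) using uc vc by (simp add: map_mult map_inv)
        moreover have "inv v \<otimes> u \<in> plus_part U"
          using u v subgroup.m_closed[OF subgroup_plus_part[OF U]]
            subgroup.m_inv_closed[OF subgroup_plus_part[OF U]] by blast
        ultimately have lP: "l \<in> plus_part U"
          using map_mem_plus_part lU by metis
        have "(\<alpha> ^^ m) l \<in> ?K"
          using Suc lP pow_mem_homoclinic[OF U lL] by blast
        then obtain b k where bk: "b \<in> minus_part U" "k \<in> (\<alpha> ^^ p) ` U" "(\<alpha> ^^ m) l = b \<otimes> k"
          unfolding set_mult_def by blast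
        have rm: "(\<alpha> ^^ m) r \<in> minus_part U"
          using late[OF r(1)] False by simp
        have c: "b \<in> carrier G" "k \<in> carrier G"
          using bk S(4) subgroup.mem_carrier[OF mU] by auto
        have "x = (\<alpha> ^^ m) (r \<otimes> l)"
          unfolding u(2) l_def using rc uc by (simp add: mult_inv_cancel_left)
        also have "\<dots> = ((\<alpha> ^^ m) r \<otimes> b) \<otimes> k"
          using rc lc c bk(3) by (simp add: m_assoc)
        finally show "x \<in> ?K"
          using subgroup.m_closed[OF mU rm bk(1)] bk(2) unfolding set_mult_def by blast
      qed
    qed
  qed
  moreover have "homoclinic U \<subseteq> (\<Union>m. homoclinic U \<inter> (\<alpha> ^^ m) ` plus_part U)"
    unfolding homoclinic_def plus_hull_def by blast
  ultimately show ?thesis by blast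
qed

text \<open>Inverting \<open>L \<subseteq> U\<^sub>- \<alpha>\<^sup>p(U)\<close> gives \<open>L \<subseteq> \<alpha>\<^sup>p(U) U\<close>, a finite union of left cosets of \<open>U\<close>.\<close>
lemma finite_translates_homoclinic:
  assumes U: "compact_open U"
  shows "finite (translates (homoclinic U) U)"
proof -
  note S = compact_openD[OF U]
  note mU = subgroup_minus_part[OF S(1)]
  obtain p where p: "homoclinic U \<subseteq> minus_part U <#> (\<alpha> ^^ p) ` U"
    using homoclinic_subset_compact_product[OF U] by blast
  note pU = subgroup_image_pow[OF S(1), of p]
  have "translates (homoclinic U) U \<subseteq> translates ((\<alpha> ^^ p) ` U) U"
  proof
    fix X assume "X \<in> translates (homoclinic U) U"
    then obtain l where l: "l \<in> homoclinic U" "X = l <# U" unfolding translates_def by blast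
    then have "inv l \<in> minus_part U <#> (\<alpha> ^^ p) ` U"
      using p subgroup.m_inv_closed[OF subgroup_homoclinic[OF U]] by blast
    then obtain b k where bk: "b \<in> minus_part U" "k \<in> (\<alpha> ^^ p) ` U" "inv l = b \<otimes> k"
      unfolding set_mult_def by blast
    have c: "b \<in> carrier G" "k \<in> carrier G" "l \<in> carrier G"
      using bk l subgroup.mem_carrier[OF mU] subgroup.mem_carrier[OF pU]
        subgroup.mem_carrier[OF subgroup_homoclinic[OF U]] by auto
    have "inv l \<otimes> inv k = b"
      using c bk(3) by (simp add: m_assoc)
    then have "inv l \<otimes> inv k \<in> U"
      using bk(1) minus_part_subset by blast
    then have "X = inv k <# U"
      using lcoset_eq_iff[OF S(1), of l "inv k"] c l(2) by simp
    then show "X \<in> translates ((\<alpha> ^^ p) ` U) U"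
      using subgroup.m_inv_closed[OF pU bk(2)] unfolding translates_def by blast
  qed
  then show ?thesis
    using finite_translates_image_pow[OF U U] finite_subset by blast
qed

lemma pos_mono: "V \<subseteq> U \<Longrightarrow> pos V n \<subseteq> pos U n"
  by (induction n) auto

lemma plus_part_mono: "V \<subseteq> U \<Longrightarrow> plus_part V \<subseteq> plus_part U"
  using pos_mono unfolding subset_iff mem_plus_part by metis

lemma minus_part_mono: "V \<subseteq> U \<Longrightarrow> minus_part V \<subseteq> minus_part U"
  unfolding subset_iff mem_minus_part by blast

lemma minus_hull_mono: "V \<subseteq> U \<Longrightarrow> minus_hull V \<subseteq> minus_hull U"
  using minus_part_mono[of V U] unfolding subset_iff mem_minus_hull by blast

text \<open>Since \<open>l U l\<^sup>-\<^sup>1\<close> depends only on the coset \<open>l U\<close>, the intersection of all these conjugates is a finite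
  one and hence open.\<close>
lemma exists_homoclinic_normalized:
  assumes U: "compact_open U"
  shows "\<exists>V. compact_open V \<and> V \<subseteq> U \<and> (\<forall>l\<in>homoclinic U. \<forall>v\<in>V. l \<otimes> v \<otimes> inv l \<in> V)"
proof -
  note S = compact_openD[OF U]
  note L = subgroup_homoclinic[OF U]
  note Lc = subgroup.mem_carrier[OF L] and Uc = subgroup.mem_carrier[OF S(1)]
  define V where "V = {x \<in> carrier G. \<forall>l\<in>homoclinic U. inv l \<otimes> x \<otimes> l \<in> U}"
  obtain F where F: "F \<subseteq> homoclinic U" "finite F" "translates (homoclinic U) U = (\<lambda>a. a <# U) ` F"
    using translates_transversal[OF finite_translates_homoclinic[OF U]] by metis
  let ?W = "\<lambda>f. {x \<in> topspace T. inv f \<otimes> x \<otimes> f \<in> U}"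
  have "V = (\<Inter>f\<in>F. ?W f) \<inter> topspace T"
  proof (intro equalityI subsetI)
    fix x assume "x \<in> V"
    then show "x \<in> (\<Inter>f\<in>F. ?W f) \<inter> topspace T"
      using F(1) unfolding V_def topspace_eq by blast
  next
    fix x assume x: "x \<in> (\<Inter>f\<in>F. ?W f) \<inter> topspace T"
    then have xc: "x \<in> carrier G" using topspace_eq by blast
    have "inv l \<otimes> x \<otimes> l \<in> U" if l: "l \<in> homoclinic U" for l
    proof -
      have "l <# U \<in> (\<lambda>a. a <# U) ` F"
        using l F(3) unfolding translates_def by blast
      then obtain f where f: "f \<in> F" "f <# U = l <# U" by auto
      have c: "f \<in> carrier G" "l \<in> carrier G" using f F(1) l Lc by auto
      define u where "u = inv f \<otimes> l"
      have u: "u \<in> U"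
        unfolding u_def using f(2) lcoset_eq_iff[OF S(1) c] by simp
      have "inv f \<otimes> x \<otimes> f \<in> U" using x f by blast
      then have "inv u \<otimes> (inv f \<otimes> x \<otimes> f) \<otimes> u \<in> U"
        using u subgroup.m_closed[OF S(1)] subgroup.m_inv_closed[OF S(1)] by blast
      moreover have "inv u \<otimes> (inv f \<otimes> x \<otimes> f) \<otimes> u = inv l \<otimes> x \<otimes> l"
        unfolding u_def using c xc by (simp add: inv_mult_group m_assoc mult_inv_cancel_left)
      ultimately show ?thesis by simp
    qed
    with xc show "x \<in> V" unfolding V_def by blast
  qed
  moreover have "openin T ((\<Inter>f\<in>F. ?W f) \<inter> topspace T)"
  proof (rule openin_INT[OF F(2)])
    fix f assume "f \<in> F"
    then have fc: "f \<in> carrier G" using F(1) Lc by blast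
    have "continuous_map T T (\<lambda>x. inv f \<otimes> x \<otimes> f)"
      using fc by (intro continuous_map_mult[OF continuous_left_mult continuous_map_const_carrier]) auto
    then show "openin T (?W f)"
      using S(3) by (rule openin_continuous_map_preimage)
  qed
  ultimately have op: "openin T V" by simp
  have VU: "V \<subseteq> U"
  proof
    fix x assume x: "x \<in> V"
    then have "inv \<one> \<otimes> x \<otimes> \<one> \<in> U"
      using subgroup.one_closed[OF L] unfolding V_def by blast
    with x show "x \<in> U" unfolding V_def by simp
  qed
  have sub: "subgroup V G"
  proof (rule subgroupI)
    show "V \<subseteq> carrier G" unfolding V_def by blast
    have "\<one> \<in> V"
      using Lc subgroup.one_closed[OF S(1)] unfolding V_def by simp
    then show "V \<noteq> {}" by blast
    show "inv a \<in> V" if a: "a \<in> V" for a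
    proof -
      have "inv l \<otimes> inv a \<otimes> l \<in> U" if l: "l \<in> homoclinic U" for l
      proof -
        have "inv (inv l \<otimes> a \<otimes> l) \<in> U"
          using a l subgroup.m_inv_closed[OF S(1)] unfolding V_def by blast
        moreover have "inv (inv l \<otimes> a \<otimes> l) = inv l \<otimes> inv a \<otimes> l"
          using a Lc[OF l] unfolding V_def by (simp add: inv_mult_group m_assoc)
        ultimately show ?thesis by simp
      qed
      with a show ?thesis unfolding V_def by simp
    qed
    show "a \<otimes> b \<in> V" if ab: "a \<in> V" "b \<in> V" for a b
    proof -
      have "inv l \<otimes> (a \<otimes> b) \<otimes> l \<in> U" if l: "l \<in> homoclinic U" for l
      proof -
        have "(inv l \<otimes> a \<otimes> l) \<otimes> (inv l \<otimes> b \<otimes> l) \<in> U"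
          using ab l subgroup.m_closed[OF S(1)] unfolding V_def by blast
        moreover have "(inv l \<otimes> a \<otimes> l) \<otimes> (inv l \<otimes> b \<otimes> l) = inv l \<otimes> (a \<otimes> b) \<otimes> l"
          using ab Lc[OF l] unfolding V_def by (simp add: m_assoc mult_inv_cancel_left)
        ultimately show ?thesis by simp
      qed
      with ab show ?thesis unfolding V_def by simp
    qed
  qed
  have "l \<otimes> v \<otimes> inv l \<in> V" if l: "l \<in> homoclinic U" and v: "v \<in> V" for l v
  proof -
    have c: "l \<in> carrier G" "v \<in> carrier G" using Lc[OF l] v unfolding V_def by auto
    have "inv m \<otimes> (l \<otimes> v \<otimes> inv l) \<otimes> m \<in> U" if m: "m \<in> homoclinic U" for m
    proof -
      have "inv l \<otimes> m \<in> homoclinic U"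
        using l m subgroup.m_closed[OF L] subgroup.m_inv_closed[OF L] by blast
      then have "inv (inv l \<otimes> m) \<otimes> v \<otimes> (inv l \<otimes> m) \<in> U"
        using v unfolding V_def by blast
      then show ?thesis
        using c Lc[OF m] by (simp add: inv_mult_group m_assoc)
    qed
    with c show ?thesis unfolding V_def by simp
  qed
  moreover have "compact_open V"
    using compact_open_subgroup_if_subset_compact[OF sub op VU S(2)] .
  ultimately show ?thesis
    using VU by blast
qed

lemma neg_normalized:
  assumes L: "L \<subseteq> carrier G" "\<And>l k. l \<in> L \<Longrightarrow> (\<alpha> ^^ k) l \<in> L"
    and norm: "\<And>l v. l \<in> L \<Longrightarrow> v \<in> V \<Longrightarrow> l \<otimes> v \<otimes> inv l \<in> V"
    and "l \<in> L" "v \<in> neg V n"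
  shows "l \<otimes> v \<otimes> inv l \<in> neg V n"
proof -
  have c: "l \<in> carrier G" "v \<in> carrier G" using assms(4,5) L(1) mem_neg by blast+
  have "(\<alpha> ^^ k) (l \<otimes> v \<otimes> inv l) \<in> V" if "k \<le> n" for k
  proof -
    have "(\<alpha> ^^ k) v \<in> V" using assms(5) that mem_neg by blast
    then show ?thesis
      using norm[OF L(2)[OF assms(4), of k]] c by simp
  qed
  with c show ?thesis unfolding mem_neg by simp
qed

text \<open>Given \<open>n\<close>, both \<open>l\<close> and \<open>v\<close> are images under \<open>\<alpha>\<^sup>n\<close>, the former of an element of \<open>L\<close> and the latter of an
  element of \<open>V\<^sub>-\<^sub>n\<close>, and \<open>L\<close> normalizes \<open>V\<^sub>-\<^sub>n\<close>.\<close>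
lemma plus_part_normalized:
  assumes L: "L \<subseteq> carrier G" "\<And>l k. l \<in> L \<Longrightarrow> (\<alpha> ^^ k) l \<in> L" "L \<subseteq> \<alpha> ` L"
    and V: "V \<subseteq> carrier G" and norm: "\<And>l v. l \<in> L \<Longrightarrow> v \<in> V \<Longrightarrow> l \<otimes> v \<otimes> inv l \<in> V"
    and "l \<in> L" "v \<in> plus_part V"
  shows "l \<otimes> v \<otimes> inv l \<in> plus_part V"
  unfolding mem_plus_part
proof
  fix n
  have "v \<in> pos V n" using assms(7) mem_plus_part by blast
  then obtain w where w: "w \<in> neg V n" "v = (\<alpha> ^^ n) w"
    unfolding pos_eq_image_neg[OF V] by blast
  obtain m where m: "m \<in> L" "(\<alpha> ^^ n) m = l"
    using backward_orbit[OF L(3) assms(6)] by blast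
  have c: "m \<in> carrier G" "w \<in> carrier G" using m w L(1) mem_neg by blast+
  have "m \<otimes> w \<otimes> inv m \<in> neg V n"
    using neg_normalized[OF L(1,2) norm m(1) w(1)] .
  moreover have "(\<alpha> ^^ n) (m \<otimes> w \<otimes> inv m) = l \<otimes> v \<otimes> inv l"
    using c m(2) w(2) by simp
  ultimately show "l \<otimes> v \<otimes> inv l \<in> pos V n"
    unfolding pos_eq_image_neg[OF V] by (metis imageI)
qed

text \<open>The last hypothesis of the factorization criterion holds for the following reason. Let
  \<open>t \<in> V\<^sub>+ L\<close> and \<open>\<alpha>\<^sup>n(t) = b l'\<close> with \<open>b \<in> V\<^sub>-\<close> and \<open>l' = \<alpha>\<^sup>n(m)\<close> for some \<open>m \<in> L\<close>. Then \<open>z = t m\<^sup>-\<^sup>1\<close> satisfies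
  \<open>\<alpha>\<^sup>n(z) = b\<close>, so \<open>z\<close> is in \<open>V\<^sub>-\<^sub>- \<subseteq> U\<^sub>-\<^sub>-\<close>; it is also in \<open>V\<^sub>+ L \<subseteq> U\<^sub>+\<^sub>+\<close>. By definition of \<open>L\<close> both \<open>z\<close> and
  \<open>t = z m\<close> belong to \<open>L\<close>. Taking \<open>L\<close> from the larger group \<open>U\<close> is what makes this work.\<close>
lemma exists_multiplicative:
  assumes U: "compact_open U"
  shows "\<exists>W. compact_open W \<and> multiplicative W"
proof -
  let ?L = "homoclinic U"
  note L = subgroup_homoclinic[OF U]
  note Lc = subgroup.mem_carrier[OF L]
  note Lpow = pow_mem_homoclinic[OF U]
  note Lim = homoclinic_subset_image[OF U]
  obtain V0 where V0: "compact_open V0" "V0 \<subseteq> U" and norm0: "\<And>l v. l \<in> ?L \<Longrightarrow> v \<in> V0 \<Longrightarrow> l \<otimes> v \<otimes> inv l \<in> V0"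
    using exists_homoclinic_normalized[OF U] by blast
  \<comment> \<open>The indices \<open>d\<^sub>1\<close> of the groups \<open>neg V0 k\<close> decrease with \<open>k\<close>. From a \<open>k\<close> on at which the minimum
    is attained they are constant, which is the condition for being tidy above.\<close>
  obtain k where k: "\<And>j. displacement 1 (neg V0 k) \<le> displacement 1 (neg V0 j)"
    using ex_has_least_nat[of "\<lambda>_. True" 0 "\<lambda>k. displacement 1 (neg V0 k)"] by blast
  define V where "V = neg V0 k"
  have V: "compact_open V" unfolding V_def using compact_open_neg[OF V0(1)] .
  note S = compact_openD[OF V]
  have VU: "V \<subseteq> U" unfolding V_def using neg_subset V0(2) by blast
  have norm: "l \<otimes> v \<otimes> inv l \<in> V" if "l \<in> ?L" "v \<in> V" for l v
    using neg_normalized[OF subgroup.subset[OF L] Lpow norm0] that unfolding V_def by blast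
  have "displacement 1 (neg V j) = displacement 1 V" for j
    using displacement_neg_antimono[OF V, of j] k[of "k + j"] unfolding V_def neg_neg by simp
  then have "tidy_above G \<alpha> V"
    using tidy_above_if_displacement_constant[OF V] by simp
  then have fac: "V = plus_part V <#> minus_part V"
    by (simp only: tidy_above_def)
  note mV = subgroup_minus_part[OF S(1)]
  define W where "W = V <#> ?L"
  define M where "M = plus_part V <#> ?L"
  define B where "B = minus_part V <#> ?L"
  have Wsub: "subgroup W G"
    unfolding W_def using subgroup_set_mult_if_normalizes[OF S(1) L norm] .
  have Msub: "subgroup M G"
    unfolding M_def
    using subgroup_set_mult_if_normalizes[OF subgroup_plus_part[OF V] L
        plus_part_normalized[OF subgroup.subset[OF L] Lpow Lim S(4) norm]] .
  have memL: "l \<in> X <#> ?L" if "l \<in> ?L" "\<one> \<in> X" for X l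
  proof -
    have "l = \<one> \<otimes> l" using Lc[OF that(1)] by simp
    with that show ?thesis unfolding set_mult_def by blast
  qed
  have VW: "V \<subseteq> W"
  proof
    fix v assume v: "v \<in> V"
    then have "v = v \<otimes> \<one>" using S(4) by auto
    with v subgroup.one_closed[OF L] show "v \<in> W" unfolding W_def set_mult_def by blast
  qed
  have Wopen: "openin T W"
    using openin_subgroup_if_contains_open_subgroup[OF Wsub S(1) S(3) VW] .
  have "finite (translates ?L V)"
    using finite_translates_trans[OF subgroup.subset[OF L] compact_openD(1)[OF U] S(1)
        finite_translates_homoclinic[OF U] finite_translates_between_compact_open[OF U V]] .
  then obtain F where F: "F \<subseteq> ?L" "finite F" "translates ?L V = (\<lambda>a. a <# V) ` F"
    using translates_transversal by metis
  have Wcover: "W \<subseteq> \<Union>(translates ?L V)"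
  proof
    fix w assume "w \<in> W"
    then obtain v l where w: "v \<in> V" "l \<in> ?L" "w = v \<otimes> l"
      unfolding W_def set_mult_def by blast
    have c: "v \<in> carrier G" "l \<in> carrier G" using w S(4) Lc by auto
    have "inv l \<otimes> v \<otimes> inv (inv l) \<in> V"
      using norm[OF subgroup.m_inv_closed[OF L w(2)] w(1)] .
    moreover have "w = l \<otimes> (inv l \<otimes> v \<otimes> inv (inv l))"
      using w c by (simp add: m_assoc mult_inv_cancel_left)
    ultimately have "w \<in> l <# V" unfolding l_coset_def by blast
    with w(2) show "w \<in> \<Union>(translates ?L V)" unfolding translates_def by blast
  qed
  have "compactin T (\<Union>(translates ?L V))"
  proof (rule compactin_Union)
    show "finite (translates ?L V)" using F by simp
    fix X assume "X \<in> translates ?L V"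
    then obtain l where l: "l \<in> ?L" "X = l <# V" unfolding translates_def by blast
    have "l <# V = (\<lambda>y. l \<otimes> y) ` V" unfolding l_coset_def by blast
    then show "compactin T X"
      using image_compactin[OF S(2) continuous_left_mult[OF Lc[OF l(1)]]] l(2) by simp
  qed
  with Wsub Wopen Wcover have W: "compact_open W"
    by (rule compact_open_subgroup_if_subset_compact)
  have "multiplicative W"
  proof (rule multiplicative_if_factorization[OF W Msub])
    show "M \<subseteq> W"
      using plus_part_subset unfolding M_def W_def set_mult_def by blast
    show "M \<subseteq> \<alpha> ` M"
    proof
      fix x assume "x \<in> M"
      then obtain v l where x: "v \<in> plus_part V" "l \<in> ?L" "x = v \<otimes> l"
        unfolding M_def set_mult_def by blast
      obtain v' where v': "v' \<in> plus_part V" "v = \<alpha> v'" using plus_part_subset_image[OF V] x(1) by blast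
      obtain l' where l': "l' \<in> ?L" "l = \<alpha> l'" using Lim x(2) by blast
      have c: "v' \<in> carrier G" "l' \<in> carrier G"
        using v' l' Lc plus_part_subset S(4) by blast+
      have "x = \<alpha> (v' \<otimes> l')" using x v' l' c by (simp add: map_mult)
      then show "x \<in> \<alpha> ` M" using v'(1) l'(1) unfolding M_def set_mult_def by blast
    qed
    show "B \<subseteq> W"
      using minus_part_subset unfolding B_def W_def set_mult_def by blast
    show "\<alpha> b \<in> B" if b: "b \<in> B" for b
    proof -
      obtain v l where x: "v \<in> minus_part V" "l \<in> ?L" "b = v \<otimes> l"
        using b unfolding B_def set_mult_def by blast
      have c: "v \<in> carrier G" "l \<in> carrier G" using x Lc subgroup.mem_carrier[OF mV] by auto
      have "\<alpha> b = \<alpha> v \<otimes> \<alpha> l" using x c by (simp add: map_mult)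
      moreover have "\<alpha> v \<in> minus_part V" "\<alpha> l \<in> ?L"
        using pow_mem_minus_part[OF x(1), of 1] Lpow[OF x(2), of 1] by simp_all
      ultimately show ?thesis unfolding B_def set_mult_def by blast
    qed
    show "W \<subseteq> M <#> B"
    proof
      fix w assume "w \<in> W"
      then obtain v l where w: "v \<in> V" "l \<in> ?L" "w = v \<otimes> l"
        unfolding W_def set_mult_def by blast
      obtain a b where ab: "a \<in> plus_part V" "b \<in> minus_part V" "v = a \<otimes> b"
        using w(1) fac unfolding set_mult_def by blast
      have c: "a \<in> carrier G" "b \<in> carrier G" "l \<in> carrier G"
        using ab w Lc subgroup.mem_carrier[OF mV] subgroup.mem_carrier[OF subgroup_plus_part[OF V]]
        by auto
      have "w = (a \<otimes> \<one>) \<otimes> (b \<otimes> l)" using w ab c by (simp add: m_assoc)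
      moreover have "a \<otimes> \<one> \<in> M"
        using ab(1) subgroup.one_closed[OF L] unfolding M_def set_mult_def by blast
      moreover have "b \<otimes> l \<in> B"
        using ab(2) w(2) unfolding B_def set_mult_def by blast
      ultimately show "w \<in> M <#> B" unfolding set_mult_def by blast
    qed
    fix t n assume t: "t \<in> M" "(\<alpha> ^^ n) t \<in> B"
    obtain y l where y: "y \<in> plus_part V" "l \<in> ?L" "t = y \<otimes> l"
      using t(1) unfolding M_def set_mult_def by blast
    obtain b l' where b: "b \<in> minus_part V" "l' \<in> ?L" "(\<alpha> ^^ n) t = b \<otimes> l'"
      using t(2) unfolding B_def set_mult_def by blast
    obtain m where m: "m \<in> ?L" "(\<alpha> ^^ n) m = l'"
      using backward_orbit[OF Lim b(2)] by blast
    have c: "y \<in> carrier G" "l \<in> carrier G" "b \<in> carrier G" "l' \<in> carrier G" "m \<in> carrier G"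
      using y b m Lc subgroup.mem_carrier[OF mV] subgroup.mem_carrier[OF subgroup_plus_part[OF V]] by auto
    define z where "z = t \<otimes> inv m"
    have zc: "z \<in> carrier G" "t \<in> carrier G" unfolding z_def y(3) using c by auto
    have "(\<alpha> ^^ n) z = b"
      unfolding z_def using b(3) m(2) c zc by (simp add: m_assoc)
    then have "z \<in> minus_hull V"
      using b(1) zc unfolding mem_minus_hull by blast
    then have zm: "z \<in> minus_hull U"
      using minus_hull_mono[OF VU] by blast
    have zp: "z \<in> plus_hull U"
    proof -
      note H = subgroup_plus_hull[OF U]
      have "y \<in> (\<alpha> ^^ 0) ` plus_part U"
        using y(1) plus_part_mono[OF VU] by auto
      then have "y \<in> plus_hull U" unfolding plus_hull_def by blast
      moreover have "l \<in> plus_hull U" "m \<in> plus_hull U"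
        using y(2) m(1) unfolding homoclinic_def by blast+
      ultimately show ?thesis
        unfolding z_def y(3) using subgroup.m_closed[OF H] subgroup.m_inv_closed[OF H] by blast
    qed
    have "t = z \<otimes> m"
      unfolding z_def using zc c by (simp add: m_assoc)
    then have "t \<in> ?L"
      using zm zp m(1) subgroup.m_closed[OF L] unfolding homoclinic_def by blast
    then show "t \<in> B"
      unfolding B_def using memL subgroup.one_closed[OF mV] by blast
  qed
  with W show ?thesis by blast
qed

section \<open>The scale\<close>

lemma endo_scale_eq:
  assumes W: "compact_open W" and m: "multiplicative W"
  shows "endo_scale G T \<alpha> = displacement 1 W"
  unfolding endo_scale_def
proof (rule Least_equality)
  show "\<exists>V. compact_open V \<and> displacement 1 W = displacement_index G \<alpha> V"
    using W displacement_index_eq by metis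
  show "displacement 1 W \<le> n" if "\<exists>V. compact_open V \<and> n = displacement_index G \<alpha> V" for n
    using that multiplicative_minimal[OF W m] displacement_index_eq by metis
qed

lemma minimizing_iff_multiplicative:
  assumes U: "compact_open U"
  shows "minimizing G T \<alpha> U \<longleftrightarrow> multiplicative U"
proof
  obtain W where W: "compact_open W" "multiplicative W"
    using exists_multiplicative[OF U] by blast
  assume "minimizing G T \<alpha> U"
  then have "displacement 1 U = displacement 1 W"
    by (simp only: minimizing_def displacement_index_eq[OF U] endo_scale_eq[OF W])
  then show "multiplicative U"
    by (rule multiplicative_if_minimal[OF W U])
next
  assume "multiplicative U"
  then show "minimizing G T \<alpha> U"
    by (simp only: minimizing_def displacement_index_eq[OF U] endo_scale_eq[OF U])
qed

text \<open>An edge from \<open>v\<^sub>0\<close> may also arise from an index \<open>i > 0\<close>, when \<open>u \<alpha>\<^sup>-\<^sup>i(U) = U\<close> for some \<open>u \<in> U\<close>. But then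
  \<open>\<alpha>\<^sup>-\<^sup>i(U) = U\<close> and \<open>\<alpha>\<^sup>-\<^sup>i\<^sup>-\<^sup>1(U) = \<alpha>\<^sup>-\<^sup>1(U)\<close>, so the edge ends at a translate of \<open>\<alpha>\<^sup>-\<^sup>1(U)\<close> anyway.\<close>
lemma out_neighbours_base_vertex:
  assumes U: "compact_open U"
  shows "out_neighbours (Gamma_plus G \<alpha> U) (base_vertex G \<alpha> U 0) = translates U (pre 1 U)"
proof -
  note S = compact_openD[OF U]
  have base: "base_vertex G \<alpha> U i = pre i U" for i
    by (simp add: base_vertex_def)
  have pre0: "pre 0 U = U"
    using S(4) by (auto simp: mem_pre)
  have self: "u <# U = U" if "u \<in> U" for u
  proof -
    have "\<one> <# U = u <# U"
      using that S(4) subgroup.one_closed[OF S(1)] by (subst lcoset_eq_iff[OF S(1)]) auto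
    then show ?thesis
      using lcos_mult_one[OF S(4)] by simp
  qed
  have pre_eq: "pre (i + 1) U = pre 1 U" if u: "u \<in> U" and eq: "U = u <# pre i U" for u i
  proof -
    have uc: "u \<in> carrier G" using u S(4) by blast
    have "pre i U = U"
    proof (intro equalityI subsetI)
      fix x assume x: "x \<in> pre i U"
      then have "u \<otimes> x \<in> U" using eq unfolding l_coset_def by blast
      then have "inv u \<otimes> (u \<otimes> x) \<in> U"
        using u subgroup.m_closed[OF S(1)] subgroup.m_inv_closed[OF S(1)] by blast
      then show "x \<in> U"
        using x uc by (simp add: mem_pre mult_inv_cancel_left)
    next
      fix x assume x: "x \<in> U"
      then have "u \<otimes> x \<in> u <# pre i U"
        using u eq subgroup.m_closed[OF S(1)] by blast
      then obtain y where y: "y \<in> pre i U" "u \<otimes> x = u \<otimes> y" unfolding l_coset_def by blast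
      then have "x = y" using x uc S(4) by (auto simp: mem_pre)
      with y show "x \<in> pre i U" by simp
    qed
    moreover have "pre (i + 1) U = pre 1 (pre i U)"
      by (auto simp: mem_pre pow_map)
    ultimately show ?thesis by simp
  qed
  show ?thesis
  proof (intro equalityI subsetI)
    fix w assume "w \<in> out_neighbours (Gamma_plus G \<alpha> U) (base_vertex G \<alpha> U 0)"
    then obtain u i where ui: "u \<in> U" "U = u <# pre i U" "w = u <# pre (i + 1) U"
      unfolding out_neighbours_def Gamma_plus_def base pre0 by auto
    then show "w \<in> translates U (pre 1 U)"
      unfolding translates_def pre_eq[OF ui(1,2)] by blast
  next
    fix w assume "w \<in> translates U (pre 1 U)"
    then obtain u where u: "u \<in> U" "w = u <# pre 1 U" unfolding translates_def by blast
    have "(U, w) = (u <# pre 0 U, u <# pre (0 + 1) U)"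
      using self[OF u(1)] pre0 u(2) by simp
    with u(1) have "\<exists>v i. (U, w) = (v <# pre i U, v <# pre (i + 1) U) \<and> v \<in> U"
      by blast
    moreover have "\<exists>v i. w = v <# pre i U \<and> v \<in> U"
      using u by blast
    ultimately show "w \<in> out_neighbours (Gamma_plus G \<alpha> U) (base_vertex G \<alpha> U 0)"
      unfolding out_neighbours_def Gamma_plus_def base pre0 by simp blast
  qed
qed

lemma card_out_neighbours_base_vertex:
  assumes U: "compact_open U"
  shows "card (out_neighbours (Gamma_plus G \<alpha> U) (base_vertex G \<alpha> U 0)) = displacement 1 U"
  unfolding out_neighbours_base_vertex[OF U] displacement_eq_index[OF U]
  using index_Int[OF compact_openD(1)[OF U] subgroup_pre[OF compact_openD(1)[OF U]]] by simp

end

theorem theorem5p6: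
  fixes G :: "('a, 'b) monoid_scheme" and T :: "'a topology"
    and \<alpha> :: "'a \<Rightarrow> 'a" and U :: "'a set"
  assumes "tdlc_group G T"
    and "\<alpha> \<in> continuous_End G T"
    and "compact_open_subgroup G T U"
  shows "(tidy G T \<alpha> U \<longleftrightarrow> minimizing G T \<alpha> U) \<and>
    (tidy G T \<alpha> U \<longrightarrow>
      endo_scale G T \<alpha> = card (out_neighbours (Gamma_plus G \<alpha> U) (base_vertex G \<alpha> U 0)))"
proof -
  interpret tdlc_endomorphism G T \<alpha>
    using assms(1,2) by (simp add: tdlc_endomorphism_def tdlc_endomorphism_axioms_def)
  have "tidy G T \<alpha> U \<longleftrightarrow> multiplicative U"
    using tidy_imp_multiplicative multiplicative_imp_tidy assms(3) by blast
  then show ?thesis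
    using minimizing_iff_multiplicative endo_scale_eq card_out_neighbours_base_vertex assms(3)
    by simp
qed

end
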